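(* Let $\Gamma$ be an infinite strongly connected almost undirected row-finite digraph. The maps $\rho:\mathcal E(\Gamma)\to\mathcal C^\infty(\Gamma)$ and $\chi:\mathcal E(\Gamma)\to X_\Gamma$ are both homeomorphisms. In particular, $\mathcal E(\Gamma)$ is a compact totally disconnected metric space.
   Context: A countable directed graph (digraph) $\Gamma$ consists of countable sets $\Gamma_V$ (vertices) and $\Gamma_{Ar}$ (arrows) with source and range maps $s,r:\Gamma_{Ar}\to\Gamma_V$ (multiple arrows and loops allowed). It is row-finite if $\#s^{-1}(v)<\infty$ for all $v$; strongly connected if for all vertices $v,w$ there is a finite path from $v$ to $w$; almost undirected if there is $N\in\mathbb N$ such that for every arrow $a$ there is a finite path of length at most $N$ from $r(a)$ to $s(a)$. **End space.** $\mathrm{Wan}(\Gamma)$ is the set of infinite paths $p=(p_i)_{i\ge1}$ such that for each finite $H\subseteq\Gamma_V$ there is $N$ with $s(p_i)\notin H$ for all $i\ge N$. For $p,q\in\mathrm{Wan}(\Gamma)$ write $p\to q$ if for every finite $H\subseteq\Gamma_V$ and $N$ there are $n_1,n_2\ge N$ and a finite path from $s(p_{n_1})$ to $s(q_{n_2})$ none of whose vertices is in $H$; $p\sim q$ means $p\to q$ and $q\to p$. $\mathcal E(\Gamma)=\mathrm{Wan}(\Gamma)/\!\sim$, $\mathcal E(p)$ is the class of $p$. For finite non-empty $H\subseteq\Gamma_V$, $v\in H$, $w\notin H$, $L_H(v,w)$ is the set of finite paths $a_1\cdots a_n$ from $v$ to $w$ with $r(a_i)\notin H$ for all $i$. $[H]_p$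 is the set of $v\in H$ such that for all $N$ there is $n\ge N$ with $s(p_n)\notin H$ and $L_H(v,s(p_n))\neq\emptyset$. The topology of $\mathcal E(\Gamma)$ has base $\{\mathcal E(p):p\in\mathrm{Wan}(\Gamma),[H]_p=I\}$, $I\subseteq H$ finite subsets of $\Gamma_V$, $H\ne\emptyset$. **$X_\Gamma$ and $\chi$.** For finite non-empty $H\subseteq\Gamma_V$ let $X_H=\{[H]_p:p\in\mathrm{Wan}(\Gamma)\}$, a finite discrete space. If $H'\subseteq H$, $[H]_p\mapsto[H']_p$ is a well-defined map $X_H\to X_{H'}$. $X_\Gamma$ is the inverse limit of the $X_H$ over the finite non-empty subsets of $\Gamma_V$ directed by inclusion, with the projective limit topology. The map $\chi$ is the well-defined map given by $\chi(\mathcal E(p))=([H]_p)_H$. **$\mathcal C^\infty(\Gamma)$ and $\rho$.** For a digraph $\Lambda$, $\mathcal C(\Lambda)$ is the set of equivalence classes of $\Lambda_V$ under the equivalence relation generated by $v\smile w$ iff there is an arrow from $v$ to $w$ or from $w$ to $v$ (connected components of the underlying undirected graph). For $H\subseteq\Gamma_V$, $\mathrm{Int}\,H=\{v\in H:r(s^{-1}(v))\subseteq H\}$; $H\sqsubset H'$ means $H\subseteq\mathrm{Int}\,H'$. Fix a vertex $v_0$ and finite sets $\{v_0\}\sqsubset D_1\sqsubset D_2\sqsubset\cdots$ with $\bigcup_nD_n=\Gamma_V$. $\Gamma^{(n)}$ is obtained from $\Gamma$ by removing the vertices in $D_n$ and all arrows going in or out of $D_n$; for $v\notin D_n$, $[v]_n\in\mathcal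 C(\Gamma^{(n)})$ is its class. The sets $\mathcal C(\Gamma^{(n)})$ are finite and $\mathcal C^\infty(\Gamma)$ is the inverse limit of $\mathcal C(\Gamma^{(1)})\leftarrow\mathcal C(\Gamma^{(2)})\leftarrow\cdots$ with the maps $[v]_{n+1}\mapsto[v]_n$, topologized as a subspace of the product of finite discrete spaces (so it is the end space of the underlying undirected graph). For $p\in\mathrm{Wan}(\Gamma)$ with $s(p_1)\in D_n$ and $j\ge n$ let $i_j$ be the largest index with $s(p_{i_j})\in D_j$; then the classes $[r(p_{i_j})]_j\in\mathcal C(\Gamma^{(j)})$, $j\ge n$, define an element of $\mathcal C^\infty(\Gamma)$ depending only on $\mathcal E(p)$, denoted $\rho(\mathcal E(p))$. *)

theory Defs
  imports "HOL-Analysis.Analysis" "Graph_Theory.Digraph_Component"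
begin

text \<open>
  Digraphs are those of the Graph Theory library (multiple arcs and loops allowed),
  with source \<^term>\<open>tail G\<close> and range \<^term>\<open>head G\<close>. Finite paths are the arc walks
  \<^term>\<open>pre_digraph.awalk G u \<pi> v\<close>, which include the empty path at a vertex; allowing it makes no
  difference below (an almost undirected digraph stays so, with bound at least 1, if loops are
  their own return paths; the other paths can be prolonged or have distinct endpoints).
  Infinite paths are sequences indexed from 0, so the first arc of \<open>p\<close> is \<open>p 0\<close>.
\<close>

definition row_finite :: "('v, 'e) pre_digraph \<Rightarrow> bool" where
  "row_finite G \<longleftrightarrow> (\<forall>v\<in>verts G. finite (out_arcs G v))"

definition almost_undirected :: "('v, 'e) pre_digraph \<Rightarrow> bool" where
  "almost_undirected G \<longleftrightarrow>
     (\<exists>N. \<forall>a\<in>arcs G. \<exists>\<pi>. pre_digraph.awalk G (head G a) \<pi> (tail G a) \<and> length \<pi> \<le> N)"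


subsection \<open>The end space\<close>

definition inf_paths :: "('v, 'e) pre_digraph \<Rightarrow> (nat \<Rightarrow> 'e) set" where
  "inf_paths G = {p. \<forall>i. p i \<in> arcs G \<and> head G (p i) = tail G (p (Suc i))}"

definition Wan :: "('v, 'e) pre_digraph \<Rightarrow> (nat \<Rightarrow> 'e) set" where
  "Wan G = {p \<in> inf_paths G.
     \<forall>H. finite H \<and> H \<subseteq> verts G \<longrightarrow> (\<exists>N. \<forall>i\<ge>N. tail G (p i) \<notin> H)}"

definition leads_to :: "('v, 'e) pre_digraph \<Rightarrow> (nat \<Rightarrow> 'e) \<Rightarrow> (nat \<Rightarrow> 'e) \<Rightarrow> bool" where
  "leads_to G p q \<longleftrightarrow>
     (\<forall>H N. finite H \<and> H \<subseteq> verts G \<longrightarrow>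
       (\<exists>n1\<ge>N. \<exists>n2\<ge>N. \<exists>\<pi>. pre_digraph.awalk G (tail G (p n1)) \<pi> (tail G (q n2)) \<and>
          set (pre_digraph.awalk_verts G (tail G (p n1)) \<pi>) \<inter> H = {}))"

definition same_end :: "('v, 'e) pre_digraph \<Rightarrow> ((nat \<Rightarrow> 'e) \<times> (nat \<Rightarrow> 'e)) set" where
  "same_end G = {(p, q). p \<in> Wan G \<and> q \<in> Wan G \<and> leads_to G p q \<and> leads_to G q p}"

definition Ends :: "('v, 'e) pre_digraph \<Rightarrow> (nat \<Rightarrow> 'e) set set" where
  "Ends G = Wan G // same_end G"

definition end_of :: "('v, 'e) pre_digraph \<Rightarrow> (nat \<Rightarrow> 'e) \<Rightarrow> (nat \<Rightarrow> 'e) set" where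
  "end_of G p = same_end G `` {p}"

definition fin_parts :: "('v, 'e) pre_digraph \<Rightarrow> 'v set set" where
  "fin_parts G = {H. H \<subseteq> verts G \<and> finite H \<and> H \<noteq> {}}"

definition leaving_paths ::
    "('v, 'e) pre_digraph \<Rightarrow> 'v set \<Rightarrow> 'v \<Rightarrow> 'v \<Rightarrow> 'e list set" where
  "leaving_paths G H v w = {\<pi>. pre_digraph.awalk G v \<pi> w \<and> (\<forall>a\<in>set \<pi>. head G a \<notin> H)}"

text \<open>The set written \<open>[H]\<^sub>p\<close>.\<close>

definition end_trace :: "('v, 'e) pre_digraph \<Rightarrow> 'v set \<Rightarrow> (nat \<Rightarrow> 'e) \<Rightarrow> 'v set" where
  "end_trace G H p =
     {v \<in> H. \<forall>N. \<exists>n\<ge>N. tail G (p n) \<notin> H \<and> leaving_paths G H v (tail G (p n)) \<noteq> {}}"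

definition end_base :: "('v, 'e) pre_digraph \<Rightarrow> (nat \<Rightarrow> 'e) set set set" where
  "end_base G =
     {{end_of G p |p. p \<in> Wan G \<and> end_trace G H p = I} |H I. H \<in> fin_parts G \<and> I \<subseteq> H}"

text \<open>That \<^term>\<open>end_base G\<close> is indeed a base of a topology is \<open>istopology_end_base\<close> below.\<close>

definition end_topology :: "('v, 'e) pre_digraph \<Rightarrow> (nat \<Rightarrow> 'e) set topology" where
  "end_topology G = topology (arbitrary union_of (\<lambda>U. U \<in> end_base G))"


subsection \<open>Inverse limits of discrete spaces\<close>

text \<open>
  \<^term>\<open>inv_limit I le X f\<close> is the limit of the sets \<open>X i\<close>, \<open>i \<in> I\<close>, along the maps
  \<open>f i j : X j \<rightarrow> X i\<close> given for \<open>le i j\<close>.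
\<close>

definition inv_limit ::
    "'i set \<Rightarrow> ('i \<Rightarrow> 'i \<Rightarrow> bool) \<Rightarrow> ('i \<Rightarrow> 'x set) \<Rightarrow> ('i \<Rightarrow> 'i \<Rightarrow> 'x \<Rightarrow> 'x) \<Rightarrow> ('i \<Rightarrow> 'x) set" where
  "inv_limit I le X f =
     {x \<in> Pi\<^sub>E I X. \<forall>i\<in>I. \<forall>j\<in>I. le i j \<longrightarrow> f i j (x j) = x i}"

definition inv_limit_topology ::
    "'i set \<Rightarrow> ('i \<Rightarrow> 'i \<Rightarrow> bool) \<Rightarrow> ('i \<Rightarrow> 'x set) \<Rightarrow> ('i \<Rightarrow> 'i \<Rightarrow> 'x \<Rightarrow> 'x) \<Rightarrow> ('i \<Rightarrow> 'x) topology" where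
  "inv_limit_topology I le X f =
     subtopology (product_topology (\<lambda>i. discrete_topology (X i)) I) (inv_limit I le X f)"


subsection \<open>The space \<open>X\<^sub>\<Gamma>\<close> and the map \<open>\<chi>\<close>\<close>

definition X_part :: "('v, 'e) pre_digraph \<Rightarrow> 'v set \<Rightarrow> 'v set set" where
  "X_part G H = end_trace G H ` Wan G"

text \<open>
  Maps prescribed on representatives are defined by \<^const>\<open>the_elem\<close> of the set of all values
  obtained; the lemmas \<open>X_bond_eq\<close>, \<open>chi_end_of\<close>,
  \<open>C_bond_component_at\<close>, \<open>rho_path_eq\<close> and \<open>rho_end_of\<close> show that these sets are singletons.
\<close>

definition X_bond :: "('v, 'e) pre_digraph \<Rightarrow> 'v set \<Rightarrow> 'v set \<Rightarrow> 'v set \<Rightarrow> 'v set" where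
  "X_bond G H' H I = the_elem {end_trace G H' p |p. p \<in> Wan G \<and> end_trace G H p = I}"

definition X_topology :: "('v, 'e) pre_digraph \<Rightarrow> ('v set \<Rightarrow> 'v set) topology" where
  "X_topology G = inv_limit_topology (fin_parts G) (\<subseteq>) (X_part G) (X_bond G)"

definition chi :: "('v, 'e) pre_digraph \<Rightarrow> (nat \<Rightarrow> 'e) set \<Rightarrow> ('v set \<Rightarrow> 'v set)" where
  "chi G c = (\<lambda>H\<in>fin_parts G. the_elem (end_trace G H ` c))"


subsection \<open>The space \<open>C\<^sup>\<infinity>(\<Gamma>)\<close> and the map \<open>\<rho>\<close>\<close>

text \<open>The equivalence relation on the vertices generated by undirected adjacency.\<close>

definition component_rel :: "('v, 'e) pre_digraph \<Rightarrow> ('v \<times> 'v) set" where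
  "component_rel L = (arcs_ends L \<union> (arcs_ends L)\<inverse>)\<^sup>* \<inter> verts L \<times> verts L"

definition components_of :: "('v, 'e) pre_digraph \<Rightarrow> 'v set set" where
  "components_of L = verts L // component_rel L"

definition component_at :: "('v, 'e) pre_digraph \<Rightarrow> 'v \<Rightarrow> 'v set" where
  "component_at L v = component_rel L `` {v}"

definition Int_verts :: "('v, 'e) pre_digraph \<Rightarrow> 'v set \<Rightarrow> 'v set" where
  "Int_verts G H = {v \<in> H. head G ` out_arcs G v \<subseteq> H}"

definition well_inside :: "('v, 'e) pre_digraph \<Rightarrow> 'v set \<Rightarrow> 'v set \<Rightarrow> bool" where
  "well_inside G H H' \<longleftrightarrow> H \<subseteq> Int_verts G H'"

text \<open>The sets \<open>D n\<close> are indexed by \<open>n \<ge> 1\<close>; the value \<open>D 0\<close> is irrelevant throughout.\<close>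

definition exhaustion :: "('v, 'e) pre_digraph \<Rightarrow> 'v \<Rightarrow> (nat \<Rightarrow> 'v set) \<Rightarrow> bool" where
  "exhaustion G v0 D \<longleftrightarrow>
     v0 \<in> verts G \<and> (\<forall>n\<ge>1. finite (D n) \<and> D n \<subseteq> verts G) \<and>
     well_inside G {v0} (D 1) \<and> (\<forall>n\<ge>1. well_inside G (D n) (D (Suc n))) \<and>
     (\<Union>n\<in>{1..}. D n) = verts G"

definition remove_verts :: "('v, 'e) pre_digraph \<Rightarrow> 'v set \<Rightarrow> ('v, 'e) pre_digraph" where
  "remove_verts G S = G \<restriction> (verts G - S)"

definition C_bond ::
    "('v, 'e) pre_digraph \<Rightarrow> (nat \<Rightarrow> 'v set) \<Rightarrow> nat \<Rightarrow> nat \<Rightarrow> 'v set \<Rightarrow> 'v set" where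
  "C_bond G D m n c = the_elem (component_at (remove_verts G (D m)) ` c)"

definition C_inf :: "('v, 'e) pre_digraph \<Rightarrow> (nat \<Rightarrow> 'v set) \<Rightarrow> (nat \<Rightarrow> 'v set) set" where
  "C_inf G D = inv_limit {1..} (\<lambda>m n. n = Suc m)
     (\<lambda>n. components_of (remove_verts G (D n))) (C_bond G D)"

definition C_inf_topology ::
    "('v, 'e) pre_digraph \<Rightarrow> (nat \<Rightarrow> 'v set) \<Rightarrow> (nat \<Rightarrow> 'v set) topology" where
  "C_inf_topology G D = inv_limit_topology {1..} (\<lambda>m n. n = Suc m)
     (\<lambda>n. components_of (remove_verts G (D n))) (C_bond G D)"

definition last_index :: "('v, 'e) pre_digraph \<Rightarrow> 'v set \<Rightarrow> (nat \<Rightarrow> 'e) \<Rightarrow> nat" where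
  "last_index G S p = (GREATEST i. tail G (p i) \<in> S)"

definition exit_component ::
    "('v, 'e) pre_digraph \<Rightarrow> (nat \<Rightarrow> 'v set) \<Rightarrow> nat \<Rightarrow> (nat \<Rightarrow> 'e) \<Rightarrow> 'v set" where
  "exit_component G D j p =
     component_at (remove_verts G (D j)) (head G (p (last_index G (D j) p)))"

definition rho_path ::
    "('v, 'e) pre_digraph \<Rightarrow> (nat \<Rightarrow> 'v set) \<Rightarrow> (nat \<Rightarrow> 'e) \<Rightarrow> (nat \<Rightarrow> 'v set)" where
  "rho_path G D p = (THE x. x \<in> C_inf G D \<and>
     (\<forall>n\<ge>1. tail G (p 0) \<in> D n \<longrightarrow> (\<forall>j\<ge>n. x j = exit_component G D j p)))"

definition rho ::
    "('v, 'e) pre_digraph \<Rightarrow> (nat \<Rightarrow> 'v set) \<Rightarrow> (nat \<Rightarrow> 'e) set \<Rightarrow> (nat \<Rightarrow> 'v set)" where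
  "rho G D c = the_elem (rho_path G D ` c)"


subsection \<open>Total disconnectedness\<close>

definition totally_disconnected_space :: "'x topology \<Rightarrow> bool" where
  "totally_disconnected_space X \<longleftrightarrow> (\<forall>S. connectedin X S \<longrightarrow> (\<exists>x. S \<subseteq> {x}))"


subsection \<open>Well-definedness\<close>

context wf_digraph
begin

definition joined_off :: "'a set \<Rightarrow> 'a \<Rightarrow> 'a \<Rightarrow> bool" where
  "joined_off H u v \<longleftrightarrow> (\<exists>\<pi>. awalk u \<pi> v \<and> set (awalk_verts u \<pi>) \<inter> H = {})"

lemma set_awalk_verts_heads:
  assumes "awalk u \<pi> v"
  shows "set (awalk_verts u \<pi>) = insert u (head G ` set \<pi>)"
  using assms by (induction \<pi> arbitrary: u) (auto simp: awalk_Cons_iff awalk_Nil_iff)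

lemma joined_off_iff:
  "joined_off H u v \<longleftrightarrow> u \<notin> H \<and> leaving_paths G H u v \<noteq> {}"
proof -
  have "awalk u \<pi> v \<and> set (awalk_verts u \<pi>) \<inter> H = {} \<longleftrightarrow>
      u \<notin> H \<and> awalk u \<pi> v \<and> (\<forall>a\<in>set \<pi>. head G a \<notin> H)" for \<pi>
    by (cases "awalk u \<pi> v") (auto simp: set_awalk_verts_heads simp del: set_awalk_verts)
  then show ?thesis
    unfolding joined_off_def leaving_paths_def by simp
qed

lemma leaving_paths_trans:
  "leaving_paths G H u v \<noteq> {} \<Longrightarrow> leaving_paths G H v w \<noteq> {} \<Longrightarrow> leaving_paths G H u w \<noteq> {}"
proof -
  assume "leaving_paths G H u v \<noteq> {}" "leaving_paths G H v w \<noteq> {}"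
  then obtain \<pi> \<sigma> where "\<pi> \<in> leaving_paths G H u v" "\<sigma> \<in> leaving_paths G H v w" by auto
  then have "\<pi> @ \<sigma> \<in> leaving_paths G H u w"
    unfolding leaving_paths_def mem_Collect_eq using awalk_appendI by (metis UnE set_append)
  then show ?thesis by auto
qed

lemma leaving_paths_mono:
  "H' \<subseteq> H \<Longrightarrow> leaving_paths G H u v \<noteq> {} \<Longrightarrow> leaving_paths G H' u v \<noteq> {}"
  unfolding leaving_paths_def by blast

lemma leads_to_iff:
  "leads_to G p q \<longleftrightarrow> (\<forall>H N. finite H \<and> H \<subseteq> verts G \<longrightarrow>
     (\<exists>n1\<ge>N. \<exists>n2\<ge>N. joined_off H (tail G (p n1)) (tail G (q n2))))"
  unfolding leads_to_def joined_off_def by blast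

lemma segment:
  assumes p: "p \<in> inf_paths G" and off: "\<And>k. k > i \<Longrightarrow> tail G (p k) \<notin> H" and "i \<le> j"
  shows "leaving_paths G H (tail G (p i)) (tail G (p j)) \<noteq> {}"
  using \<open>i \<le> j\<close>
proof (induction j rule: dec_induct)
  case base
  have "p i \<in> arcs G" using p by (auto simp: inf_paths_def)
  then have "[] \<in> leaving_paths G H (tail G (p i)) (tail G (p i))"
    by (auto simp: leaving_paths_def awalk_Nil_iff)
  then show ?case by blast
next
  case (step n)
  have a: "p n \<in> arcs G" and h: "head G (p n) = tail G (p (Suc n))"
    using p by (auto simp: inf_paths_def)
  have "[p n] \<in> leaving_paths G H (tail G (p n)) (tail G (p (Suc n)))"
    using a h off[of "Suc n"] step
    by (simp add: leaving_paths_def awalk_Cons_iff awalk_Nil_iff) (metis h head_in_verts)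
  then show ?case using step leaving_paths_trans by blast
qed

lemma Wan_inf_paths: "p \<in> Wan G \<Longrightarrow> p \<in> inf_paths G"
  by (simp add: Wan_def)

lemma Wan_off:
  assumes "p \<in> Wan G" "finite H" "H \<subseteq> verts G"
  obtains N where "\<And>i. i \<ge> N \<Longrightarrow> tail G (p i) \<notin> H"
  using assms unfolding Wan_def by blast

lemma leads_to_refl: assumes "p \<in> Wan G" shows "leads_to G p p"
  unfolding leads_to_iff
proof (intro allI impI)
  fix H N assume H: "finite H \<and> H \<subseteq> verts G"
  obtain M where M: "\<And>i. i \<ge> M \<Longrightarrow> tail G (p i) \<notin> H" using Wan_off assms H by metis
  have "joined_off H (tail G (p (max M N))) (tail G (p (max M N)))"
    unfolding joined_off_iff using segment[of p "max M N" H "max M N"] M Wan_inf_paths[OF assms]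
    by auto
  then show "\<exists>n1\<ge>N. \<exists>n2\<ge>N. joined_off H (tail G (p n1)) (tail G (p n2))"
    by (intro exI[of _ "max M N"] conjI) auto
qed

lemma leads_to_trans:
  assumes "q \<in> Wan G" "leads_to G p q" "leads_to G q r"
  shows "leads_to G p r"
  unfolding leads_to_iff
proof (intro allI impI)
  fix H N assume H: "finite H \<and> H \<subseteq> verts G"
  obtain M where M: "\<And>i. i \<ge> M \<Longrightarrow> tail G (q i) \<notin> H" using Wan_off assms H by metis
  obtain a b where ab: "a \<ge> max M N" "b \<ge> max M N" "joined_off H (tail G (p a)) (tail G (q b))"
    using assms(2) H unfolding leads_to_iff by blast
  obtain c d where cd: "c \<ge> b" "d \<ge> b" "joined_off H (tail G (q c)) (tail G (r d))"
    using assms(3) H unfolding leads_to_iff by blast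
  have "leaving_paths G H (tail G (q b)) (tail G (q c)) \<noteq> {}"
    using segment[OF Wan_inf_paths[OF assms(1)], of b H c] M ab cd by auto
  then have "joined_off H (tail G (p a)) (tail G (r d))"
    using ab(3) cd(3) leaving_paths_trans unfolding joined_off_iff by blast
  then show "\<exists>n1\<ge>N. \<exists>n2\<ge>N. joined_off H (tail G (p n1)) (tail G (r n2))"
    using ab cd by (intro exI[of _ a] conjI exI[of _ d]) auto
qed

lemma equiv_same_end: "equiv (Wan G) (same_end G)"
proof (rule equivI)
  show "refl_on (Wan G) (same_end G)"
    using leads_to_refl by (auto simp: refl_on_def same_end_def)
  show "same_end G \<subseteq> Wan G \<times> Wan G" by (auto simp: same_end_def)
  show "sym (same_end G)" by (auto simp: sym_def same_end_def)
  show "trans (same_end G)"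
    unfolding trans_def same_end_def using leads_to_trans by blast
qed

lemma end_trace_mono:
  assumes "p \<in> Wan G" "q \<in> Wan G" "leads_to G p q" "H \<in> fin_parts G"
  shows "end_trace G H p \<subseteq> end_trace G H q"
proof
  fix v assume v: "v \<in> end_trace G H p"
  have H: "finite H" "H \<subseteq> verts G" using assms by (auto simp: fin_parts_def)
  obtain M where M: "\<And>i. i \<ge> M \<Longrightarrow> tail G (p i) \<notin> H" using Wan_off assms H by metis
  obtain M' where M': "\<And>i. i \<ge> M' \<Longrightarrow> tail G (q i) \<notin> H" using Wan_off assms H by metis
  have "\<exists>n\<ge>N. tail G (q n) \<notin> H \<and> leaving_paths G H v (tail G (q n)) \<noteq> {}" for N
  proof -
    obtain n where n: "n \<ge> M" "leaving_paths G H v (tail G (p n)) \<noteq> {}"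
      using v unfolding end_trace_def by blast
    obtain a b where ab: "a \<ge> max n (max M' N)" "b \<ge> max n (max M' N)"
      "joined_off H (tail G (p a)) (tail G (q b))"
      using assms(3) H unfolding leads_to_iff by blast
    have "leaving_paths G H (tail G (p n)) (tail G (p a)) \<noteq> {}"
      using segment[OF Wan_inf_paths[OF assms(1)], of n H a] M n ab by auto
    then have "leaving_paths G H v (tail G (q b)) \<noteq> {}"
      using ab(3) n(2) leaving_paths_trans unfolding joined_off_iff by blast
    then show ?thesis using ab M' by (intro exI[of _ b]) auto
  qed
  then show "v \<in> end_trace G H q" using v unfolding end_trace_def by blast
qed

lemma end_trace_cong:
  assumes "(p, q) \<in> same_end G" "H \<in> fin_parts G"
  shows "end_trace G H p = end_trace G H q"
  using assms end_trace_mono unfolding same_end_def by blast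

lemma end_trace_restrict:
  assumes p: "p \<in> Wan G" and H: "H \<in> fin_parts G" and H': "H' \<in> fin_parts G" and sub: "H' \<subseteq> H"
  shows "end_trace G H' p =
    {v \<in> H'. v \<in> end_trace G H p \<or> (\<exists>w\<in>end_trace G H p - H'. leaving_paths G H' v w \<noteq> {})}"
    (is "_ = ?R")
proof
  have fH: "finite H" "H \<subseteq> verts G" using H by (auto simp: fin_parts_def)
  obtain M where M: "\<And>i. i \<ge> M \<Longrightarrow> tail G (p i) \<notin> H" using Wan_off p fH by metis
  have tr: "w \<in> end_trace G H p" if "w \<in> H" "n \<ge> M" "leaving_paths G H w (tail G (p n)) \<noteq> {}" for w n
  proof -
    have "tail G (p k) \<notin> H \<and> leaving_paths G H w (tail G (p k)) \<noteq> {}" if "k \<ge> n" for k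
      using segment[OF Wan_inf_paths[OF p], of n H k] M that \<open>n \<ge> M\<close>
        leaving_paths_trans[OF \<open>leaving_paths G H w (tail G (p n)) \<noteq> {}\<close>] by auto
    then have "\<forall>N. \<exists>k\<ge>N. tail G (p k) \<notin> H \<and> leaving_paths G H w (tail G (p k)) \<noteq> {}"
      by (meson nat_le_linear order_refl)
    then show ?thesis using \<open>w \<in> H\<close> unfolding end_trace_def by blast
  qed
  show "end_trace G H' p \<subseteq> ?R"
  proof
    fix v assume v: "v \<in> end_trace G H' p"
    then have vH': "v \<in> H'" by (simp add: end_trace_def)
    obtain n where n: "n \<ge> M" "leaving_paths G H' v (tail G (p n)) \<noteq> {}"
      using v unfolding end_trace_def by blast
    have split: "leaving_paths G H u z \<noteq> {} \<or>
        (\<exists>w\<in>H - H'. leaving_paths G H' u w \<noteq> {} \<and> leaving_paths G H w z \<noteq> {})"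
      if "\<pi> \<in> leaving_paths G H' u z" for \<pi> u z
      using that
    proof (induction \<pi> arbitrary: u)
      case Nil
      then show ?case unfolding leaving_paths_def by auto
    next
      case (Cons e es)
      then have e: "e \<in> arcs G" "u = tail G e" "head G e \<notin> H'"
        and es: "es \<in> leaving_paths G H' (head G e) z"
        by (auto simp: leaving_paths_def awalk_Cons_iff)
      have e1: "[e] \<in> leaving_paths G H' u (head G e)"
        using e by (auto simp: leaving_paths_def awalk_Cons_iff awalk_Nil_iff)
      have e2: "[e] \<in> leaving_paths G H u (head G e)" if "head G e \<notin> H"
        using e that by (auto simp: leaving_paths_def awalk_Cons_iff awalk_Nil_iff)
      from Cons.IH[OF es] show ?case
      proof
        assume "leaving_paths G H (head G e) z \<noteq> {}"
        then show ?thesis using e e1 e2 leaving_paths_trans[of H u "head G e" z] by blast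
      next
        assume "\<exists>w\<in>H - H'. leaving_paths G H' (head G e) w \<noteq> {} \<and> leaving_paths G H w z \<noteq> {}"
        then show ?thesis using e1 leaving_paths_trans[of H' u "head G e"] by blast
      qed
    qed
    show "v \<in> ?R"
      using n split tr vH' sub by blast
  qed
  have mono: "w \<in> end_trace G H p \<Longrightarrow> \<exists>n\<ge>N. tail G (p n) \<notin> H' \<and> leaving_paths G H' w (tail G (p n)) \<noteq> {}"
    for w N
    using leaving_paths_mono[OF sub] sub unfolding end_trace_def by blast
  show "?R \<subseteq> end_trace G H' p"
  proof
    fix v assume v: "v \<in> ?R"
    then consider "v \<in> end_trace G H p"
      | w where "w \<in> end_trace G H p" "leaving_paths G H' v w \<noteq> {}" by blast
    then have "\<forall>N. \<exists>n\<ge>N. tail G (p n) \<notin> H' \<and> leaving_paths G H' v (tail G (p n)) \<noteq> {}"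
    proof cases
      case 1 then show ?thesis using mono by blast
    next
      case 2 then show ?thesis using mono leaving_paths_trans by meson
    qed
    then show "v \<in> end_trace G H' p" using v unfolding end_trace_def by blast
  qed
qed

lemma end_trace_restrict_cong:
  assumes "p \<in> Wan G" "q \<in> Wan G" "H \<in> fin_parts G" "H' \<in> fin_parts G" "H' \<subseteq> H"
    and "end_trace G H p = end_trace G H q"
  shows "end_trace G H' p = end_trace G H' q"
  unfolding end_trace_restrict[OF assms(1,3,4,5)] end_trace_restrict[OF assms(2,3,4,5)] assms(6) ..

lemma X_bond_eq:
  assumes "p \<in> Wan G" "H \<in> fin_parts G" "H' \<in> fin_parts G" "H' \<subseteq> H"
  shows "X_bond G H' H (end_trace G H p) = end_trace G H' p"
proof -
  have "{end_trace G H' q |q. q \<in> Wan G \<and> end_trace G H q = end_trace G H p} = {end_trace G H' p}"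
    using end_trace_restrict_cong assms by blast
  then show ?thesis by (simp add: X_bond_def)
qed

lemma chi_end_of:
  assumes "p \<in> Wan G"
  shows "chi G (end_of G p) = (\<lambda>H\<in>fin_parts G. end_trace G H p)"
proof -
  have "end_trace G H ` end_of G p = {end_trace G H p}" if "H \<in> fin_parts G" for H
  proof
    show "end_trace G H ` end_of G p \<subseteq> {end_trace G H p}"
      using end_trace_cong[OF _ that] unfolding end_of_def by blast
    show "{end_trace G H p} \<subseteq> end_trace G H ` end_of G p"
      using equiv_class_self[OF equiv_same_end assms] unfolding end_of_def by blast
  qed
  then show ?thesis unfolding chi_def by (intro restrict_ext) simp
qed

lemma istopology_end_base: "istopology (arbitrary union_of (\<lambda>U. U \<in> end_base G))"
proof -
  let ?E = "\<lambda>H I. {end_of G p |p. p \<in> Wan G \<and> end_trace G H p = I}"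
  have one: "(arbitrary union_of (\<lambda>U. U \<in> end_base G)) (U \<inter> V)"
    if "U \<in> end_base G" "V \<in> end_base G" for U V
  proof -
    obtain H I where U: "U = ?E H I" and H: "H \<in> fin_parts G"
      using \<open>U \<in> end_base G\<close> unfolding end_base_def by blast
    obtain K J where V: "V = ?E K J" and K: "K \<in> fin_parts G"
      using \<open>V \<in> end_base G\<close> unfolding end_base_def by blast
    have HK: "H \<union> K \<in> fin_parts G" using H K by (auto simp: fin_parts_def)
    let ?F = "{?E (H \<union> K) L |L. L \<subseteq> H \<union> K \<and> ?E (H \<union> K) L \<subseteq> U \<inter> V}"
    have "x \<in> \<Union>?F" if x: "x \<in> U \<inter> V" for x
    proof -
      obtain p where p: "p \<in> Wan G" "x = end_of G p" "end_trace G H p = I"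
        using x unfolding U by blast
      obtain q where q: "q \<in> Wan G" "x = end_of G q" "end_trace G K q = J"
        using x unfolding V by blast
      have "(p, q) \<in> same_end G"
        using p q eq_equiv_class[OF _ equiv_same_end] unfolding end_of_def by metis
      then have pK: "end_trace G K p = J" using end_trace_cong K q by blast
      let ?L = "end_trace G (H \<union> K) p"
      have "?L \<subseteq> H \<union> K" by (auto simp: end_trace_def)
      moreover have "?E (H \<union> K) ?L \<subseteq> U \<inter> V"
      proof
        fix y assume "y \<in> ?E (H \<union> K) ?L"
        then obtain r where r: "r \<in> Wan G" "y = end_of G r" "end_trace G (H \<union> K) r = ?L" by blast
        have "end_trace G H r = I" "end_trace G K r = J"
          using end_trace_restrict_cong[OF r(1) p(1) HK _ _ r(3)] H K p pK by auto
        then show "y \<in> U \<inter> V" using r unfolding U V by blast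
      qed
      moreover have "x \<in> ?E (H \<union> K) ?L" using p by blast
      ultimately show ?thesis by blast
    qed
    then have "\<Union>?F = U \<inter> V" by blast
    moreover have "?F \<subseteq> Collect (\<lambda>U. U \<in> end_base G)" using HK unfolding end_base_def by blast
    ultimately show ?thesis
      unfolding union_of_def arbitrary_def by (intro exI[of _ ?F] conjI TrueI)
  qed
  then show ?thesis unfolding istopology_base_eq by simp
qed

lemma openin_end_topology:
  "openin (end_topology G) = arbitrary union_of (\<lambda>U. U \<in> end_base G)"
  unfolding end_topology_def using istopology_end_base by (rule topology_inverse')

lemma topspace_end_topology:
  assumes "verts G \<noteq> {}"
  shows "topspace (end_topology G) = Ends G"
proof
  have E: "Ends G = end_of G ` Wan G" by (auto simp: Ends_def end_of_def quotient_def)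
  show "topspace (end_topology G) \<subseteq> Ends G"
    unfolding topspace_def openin_end_topology E union_of_def arbitrary_def end_base_def by blast
  show "Ends G \<subseteq> topspace (end_topology G)"
  proof
    fix x assume "x \<in> Ends G"
    then obtain p where p: "p \<in> Wan G" "x = end_of G p" unfolding E by blast
    obtain v where v: "v \<in> verts G" using assms by blast
    let ?U = "{end_of G q |q. q \<in> Wan G \<and> end_trace G {v} q = end_trace G {v} p}"
    have "{v} \<in> fin_parts G" "end_trace G {v} p \<subseteq> {v}"
      using v by (auto simp: fin_parts_def end_trace_def)
    then have "?U \<in> end_base G" unfolding end_base_def mem_Collect_eq
      by (intro exI[of _ "{v}"] exI[of _ "end_trace G {v} p"] conjI refl)
    then have "openin (end_topology G) ?U"
      unfolding openin_end_topology by (rule arbitrary_union_of_inc)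
    moreover have "x \<in> ?U" using p by blast
    ultimately show "x \<in> topspace (end_topology G)" unfolding topspace_def by blast
  qed
qed

lemma equiv_component_rel: "equiv (verts L) (component_rel L)"
proof (rule equivI)
  show "component_rel L \<subseteq> verts L \<times> verts L" by (auto simp: component_rel_def)
  show "refl_on (verts L) (component_rel L)" by (auto simp: component_rel_def refl_on_def)
  have "sym ((arcs_ends L \<union> (arcs_ends L)\<inverse>)\<^sup>*)" by (intro sym_rtrancl) (auto simp: sym_def)
  then show "sym (component_rel L)" by (auto simp: component_rel_def sym_def)
  show "trans (component_rel L)" unfolding component_rel_def trans_def by (auto intro: rtrancl_trans)
qed

lemma component_at_eq:
  "(u, v) \<in> component_rel L \<Longrightarrow> component_at L u = component_at L v"
  unfolding component_at_def by (rule equiv_class_eq[OF equiv_component_rel])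

lemma component_rel_mono:
  assumes "S \<subseteq> T" shows "component_rel (remove_verts G T) \<subseteq> component_rel (remove_verts G S)"
proof -
  have "arcs_ends (remove_verts G T) \<subseteq> arcs_ends (remove_verts G S)"
    using assms by (auto simp: arcs_ends_conv remove_verts_def)
  then have "(arcs_ends (remove_verts G T) \<union> (arcs_ends (remove_verts G T))\<inverse>)\<^sup>*
      \<subseteq> (arcs_ends (remove_verts G S) \<union> (arcs_ends (remove_verts G S))\<inverse>)\<^sup>*"
    by (intro rtrancl_mono) auto
  then show ?thesis using assms by (auto simp: component_rel_def remove_verts_def)
qed

lemma C_bond_component_at:
  assumes "D m \<subseteq> D n" "v \<in> verts G - D n"
  shows "C_bond G D m n (component_at (remove_verts G (D n)) v) =
    component_at (remove_verts G (D m)) v"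
proof -
  have v: "v \<in> component_at (remove_verts G (D n)) v"
    unfolding component_at_def
    using assms by (intro equiv_class_self[OF equiv_component_rel]) (simp add: remove_verts_def)
  have "component_at (remove_verts G (D m)) w = component_at (remove_verts G (D m)) v"
    if "w \<in> component_at (remove_verts G (D n)) v" for w
  proof (rule component_at_eq[symmetric])
    show "(v, w) \<in> component_rel (remove_verts G (D m))"
      using that component_rel_mono[OF assms(1)] unfolding component_at_def by auto
  qed
  then have "component_at (remove_verts G (D m)) ` component_at (remove_verts G (D n)) v
      = (\<lambda>_. component_at (remove_verts G (D m)) v) ` component_at (remove_verts G (D n)) v"
    by (rule image_cong[OF refl])
  also have "\<dots> = {component_at (remove_verts G (D m)) v}"
    using v by (rule image_constant)
  finally have "component_at (remove_verts G (D m)) ` component_at (remove_verts G (D n)) v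
      = {component_at (remove_verts G (D m)) v}" .
  then show ?thesis by (simp add: C_bond_def)
qed

lemma leaving_paths_component:
  assumes "leaving_paths G S u v \<noteq> {}" "u \<notin> S"
  shows "(u, v) \<in> component_rel (remove_verts G S)"
proof -
  obtain \<pi> where "\<pi> \<in> leaving_paths G S u v" using assms by blast
  then show ?thesis using assms(2)
  proof (induction \<pi> arbitrary: u)
    case Nil
    then show ?case
      by (auto simp: leaving_paths_def awalk_Nil_iff component_rel_def remove_verts_def)
  next
    case (Cons e es)
    then have e: "e \<in> arcs G" "u = tail G e" "head G e \<notin> S"
      and es: "es \<in> leaving_paths G S (head G e) v"
      by (auto simp: leaving_paths_def awalk_Cons_iff)
    have "(u, head G e) \<in> arcs_ends (remove_verts G S)"
      using e Cons.prems by (auto simp: arcs_ends_conv remove_verts_def)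
    then have "(u, head G e) \<in> component_rel (remove_verts G S)"
      using e Cons.prems by (auto simp: component_rel_def remove_verts_def)
    then show ?case
      using Cons.IH[OF es e(3)] equiv_component_rel by (meson equivE transE)
  qed
qed

lemma component_at_tail_const:
  assumes "p \<in> Wan G" "\<And>i. i \<ge> k \<Longrightarrow> tail G (p i) \<notin> S" "i \<ge> k"
  shows "component_at (remove_verts G S) (tail G (p i)) = component_at (remove_verts G S) (tail G (p k))"
proof -
  have "leaving_paths G S (tail G (p k)) (tail G (p i)) \<noteq> {}"
    using segment[OF Wan_inf_paths[OF assms(1)], of k S i] assms by auto
  from component_at_eq[OF leaving_paths_component[OF this]] assms(2)[of k] show ?thesis by simp
qed

definition off_index :: "'a set \<Rightarrow> (nat \<Rightarrow> 'b) \<Rightarrow> nat" where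
  "off_index S p = (LEAST k. \<forall>i\<ge>k. tail G (p i) \<notin> S)"

lemma off_index:
  assumes "p \<in> Wan G" "finite S" "S \<subseteq> verts G" "i \<ge> off_index S p"
  shows "tail G (p i) \<notin> S"
proof -
  have "\<exists>k. \<forall>i\<ge>k. tail G (p i) \<notin> S" using Wan_off assms by metis
  then have "\<forall>i\<ge>off_index S p. tail G (p i) \<notin> S" unfolding off_index_def by (rule LeastI_ex)
  then show ?thesis using assms by blast
qed

lemma exit_component_eq:
  assumes p: "p \<in> Wan G" and D: "finite (D j)" "D j \<subseteq> verts G" and i: "tail G (p i) \<in> D j"
  shows "exit_component G D j p =
    component_at (remove_verts G (D j)) (tail G (p (off_index (D j) p)))"
proof -
  let ?P = "\<lambda>i. tail G (p i) \<in> D j" and ?l = "last_index G (D j) p"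
  have bnd: "?P y \<Longrightarrow> y \<le> off_index (D j) p" for y
    using off_index[OF p D] by (meson nat_le_linear)
  have l: "?P ?l" unfolding last_index_def by (rule GreatestI_nat[of ?P, OF i bnd])
  have le: "y \<le> ?l" if "?P y" for y
    unfolding last_index_def by (rule Greatest_le_nat[of ?P, OF that bnd])
  have off: "tail G (p y) \<notin> D j" if "y \<ge> Suc ?l" for y using le that by fastforce
  have h: "head G (p ?l) = tail G (p (Suc ?l))"
    using Wan_inf_paths[OF p] by (auto simp: inf_paths_def)
  define K where "K = max (Suc ?l) (off_index (D j) p)"
  have "component_at (remove_verts G (D j)) (tail G (p K)) =
      component_at (remove_verts G (D j)) (tail G (p (Suc ?l)))"
    by (rule component_at_tail_const[OF p off]) (auto simp: K_def)
  moreover have "component_at (remove_verts G (D j)) (tail G (p K)) =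
      component_at (remove_verts G (D j)) (tail G (p (off_index (D j) p)))"
    by (rule component_at_tail_const[OF p off_index[OF p D]]) (auto simp: K_def)
  ultimately show ?thesis by (simp add: exit_component_def h)
qed

lemma exhaustionD:
  assumes "exhaustion G v0 D" "n \<ge> 1"
  shows "finite (D n)" "D n \<subseteq> verts G" "D n \<subseteq> D (Suc n)"
  using assms by (auto simp: exhaustion_def well_inside_def Int_verts_def)

lemma rho_path_eq:
  assumes ex: "exhaustion G v0 D" and p: "p \<in> Wan G"
  shows "rho_path G D p = (\<lambda>j\<in>{1..}. component_at (remove_verts G (D j)) (tail G (p (off_index (D j) p))))"
    (is "_ = ?x")
    and "rho_path G D p \<in> C_inf G D"
proof -
  let ?c = "\<lambda>j v. component_at (remove_verts G (D j)) v"
  have V: "tail G (p i) \<in> verts G" for i using Wan_inf_paths[OF p] by (auto simp: inf_paths_def)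
  have bond: "C_bond G D m (Suc m) (?x (Suc m)) = ?x m" if m: "m \<ge> 1" for m
  proof -
    note E = exhaustionD[OF ex m] and E' = exhaustionD[OF ex, of "Suc m", simplified]
    define k where "k = off_index (D (Suc m)) p"
    define K where "K = max k (off_index (D m) p)"
    have off: "tail G (p i) \<notin> D (Suc m)" if "i \<ge> k" for i
      using off_index[OF p E'(1,2)] that unfolding k_def by blast
    have "C_bond G D m (Suc m) (?c (Suc m) (tail G (p k))) = ?c m (tail G (p k))"
      by (rule C_bond_component_at) (use E off V in auto)
    also have "\<dots> = ?c m (tail G (p K))"
      by (rule component_at_tail_const[OF p, symmetric]) (use E off in \<open>auto simp: K_def\<close>)
    also have "\<dots> = ?c m (tail G (p (off_index (D m) p)))"
      by (rule component_at_tail_const[OF p off_index[OF p E(1,2)]]) (auto simp: K_def)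
    finally show ?thesis using m by (simp add: k_def)
  qed
  have "?c j (tail G (p (off_index (D j) p))) \<in> components_of (remove_verts G (D j))" if "j \<ge> 1" for j
    unfolding components_of_def component_at_def
    using off_index[OF p exhaustionD(1,2)[OF ex that]] V
    by (intro quotientI) (auto simp: remove_verts_def)
  then have x: "?x \<in> C_inf G D"
    unfolding C_inf_def inv_limit_def using bond by auto
  let ?Q = "\<lambda>x. \<forall>n\<ge>1. tail G (p 0) \<in> D n \<longrightarrow> (\<forall>j\<ge>n. x j = exit_component G D j p)"
  have D_mono: "D n \<subseteq> D j" if "1 \<le> n" "n \<le> j" for n j
    using that(2)
  proof (induction j rule: dec_induct)
    case (step j) then show ?case using exhaustionD(3)[OF ex, of j] that(1) by auto
  qed simp
  have Q: "?Q ?x"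
  proof (intro allI impI)
    fix n j assume nj: "1 \<le> n" "tail G (p 0) \<in> D n" "n \<le> j"
    then have "tail G (p 0) \<in> D j" using D_mono by blast
    then have "exit_component G D j p = ?c j (tail G (p (off_index (D j) p)))"
      using nj by (intro exit_component_eq[OF p] exhaustionD[OF ex]) auto
    then show "?x j = exit_component G D j p" using nj by simp
  qed
  obtain n0 where n0: "n0 \<ge> 1" "tail G (p 0) \<in> D n0"
    using ex V[of 0] unfolding exhaustion_def by blast
  have uniq: "y = ?x" if y: "y \<in> C_inf G D" "?Q y" for y
  proof (rule PiE_ext[of _ "{1..}" "\<lambda>n. components_of (remove_verts G (D n))"])
    show "y \<in> Pi\<^sub>E {1..} (\<lambda>n. components_of (remove_verts G (D n)))"
      "?x \<in> Pi\<^sub>E {1..} (\<lambda>n. components_of (remove_verts G (D n)))"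
      using x y(1) unfolding C_inf_def inv_limit_def by blast+
    have yb: "C_bond G D m (Suc m) (y (Suc m)) = y m" if "m \<ge> 1" for m
      using y(1) that unfolding C_inf_def inv_limit_def by auto
    have ge: "y j = ?x j" if "j \<ge> n0" for j
      by (rule trans[OF y(2)[rule_format, OF n0 that] Q[rule_format, OF n0 that, symmetric]])
    show "y j = ?x j" if "j \<in> {1..}" for j
    proof (cases "j \<ge> n0")
      case False
      then have "j \<le> n0" by simp
      then have "1 \<le> j \<longrightarrow> y j = ?x j"
      proof (induction j rule: inc_induct)
        case base then show ?case using ge[OF order_refl] by (intro impI)
      next
        case (step m)
        show ?case
        proof
          assume m: "1 \<le> m"
          then have "y (Suc m) = ?x (Suc m)" using step.IH by (meson le_SucI)
          then have "C_bond G D m (Suc m) (y (Suc m)) = C_bond G D m (Suc m) (?x (Suc m))"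
            by (rule arg_cong)
          then show "y m = ?x m" unfolding yb[OF m] bond[OF m] .
        qed
      qed
      then show ?thesis using that by simp
    qed (rule ge)
  qed
  show eq: "rho_path G D p = ?x"
    unfolding rho_path_def using x Q uniq by (intro the_equality) blast+
  show "rho_path G D p \<in> C_inf G D" unfolding eq by (rule x)
qed

lemma rho_end_of:
  assumes ex: "exhaustion G v0 D" and p: "p \<in> Wan G"
  shows "rho G D (end_of G p) = rho_path G D p"
proof -
  have "rho_path G D q = rho_path G D p" if "(p, q) \<in> same_end G" for q
  proof -
    have q: "q \<in> Wan G" and pq: "leads_to G p q" using that by (auto simp: same_end_def)
    have "component_at (remove_verts G (D j)) (tail G (p (off_index (D j) p))) =
        component_at (remove_verts G (D j)) (tail G (q (off_index (D j) q)))" if "j \<ge> 1" for j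
    proof -
      note E = exhaustionD(1,2)[OF ex that]
      obtain a b where ab: "a \<ge> off_index (D j) p" "b \<ge> off_index (D j) q"
        "joined_off (D j) (tail G (p a)) (tail G (q b))"
        using pq E unfolding leads_to_iff by (metis max.bounded_iff)
      have "component_at (remove_verts G (D j)) (tail G (p a)) =
          component_at (remove_verts G (D j)) (tail G (q b))"
        using ab(3) unfolding joined_off_iff
        by (intro component_at_eq leaving_paths_component) auto
      then show ?thesis
        using component_at_tail_const[OF p off_index[OF p E] ab(1)]
          component_at_tail_const[OF q off_index[OF q E] ab(2)] by simp
    qed
    then show ?thesis unfolding rho_path_eq(1)[OF ex p] rho_path_eq(1)[OF ex q]
      by (intro restrict_ext) simp
  qed
  moreover have "p \<in> end_of G p"
    unfolding end_of_def by (rule equiv_class_self[OF equiv_same_end p])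
  ultimately have "rho_path G D ` end_of G p = {rho_path G D p}"
    unfolding end_of_def by blast
  then show ?thesis by (simp add: rho_def)
qed

end

end

theory Submission
  imports Defs
begin

text \<open>
  The key point is that an almost undirected row-finite digraph looks undirected from far away. If
  every arc can be undone by a walk of length at most \<open>N\<close>, and \<open>H\<close> is a finite set of vertices,
  then an arc starting outside the (finite) ball of radius \<open>N\<close> around \<open>H\<close> can be undone without
  meeting \<open>H\<close>. Hence any two vertices in the same undirected component of the complement of a
  sufficiently large \<open>D n\<close> are joined in both directions by directed walks off \<open>H\<close>
  (\<open>components_strongly_joined\<close>). Three consequences follow.

  \<^item> A wandering path is determined up to equivalence by the components in which it eventually
    lies, so \<open>\<rho>\<close> is injective (\<open>same_end_if_rho_eq\<close>).
  \<^item> Conversely, vertices chosen in the successive components of a thread can, after passing to a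
    sparse subsequence, be linked by directed walks that avoid larger and larger sets, so \<open>\<rho>\<close> is
    surjective (\<open>rho_surjective\<close>).
  \<^item> The trace \<open>[H]\<^sub>p\<close> depends only on one component of \<open>\<rho>\<close>
    (\<open>end_trace_determined_by_rho\<close>), so \<open>\<rho>\<close> is open.

  In the other direction, the trace on \<open>D (Suc n)\<close> is a nonempty set of vertices outside \<open>D n\<close>, all
  of them in the component of the end at level \<open>n\<close> (\<open>rho_determined_by_end_trace\<close>). So \<open>\<rho>\<close> is
  continuous, and \<open>\<chi>\<close>, which records all traces, is injective.

  Strong connectedness makes each level of the component system finite, hence \<open>C\<^sup>\<infinity>(\<Gamma>)\<close> is a compact
  metrizable totally disconnected space, and so is the end space. The map \<open>\<chi>\<close> is continuous by the
  very definition of the topology of ends; compactness gives its surjectivity by the finite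
  intersection property, and makes a continuous bijection to a Hausdorff space a homeomorphism.
\<close>


section \<open>Inverse limits of discrete spaces\<close>

lemma topspace_inv_limit_topology: "topspace (inv_limit_topology I le X f) = inv_limit I le X f"
  by (auto simp: inv_limit_topology_def inv_limit_def)

lemma openin_inv_limit_coordinate:
  assumes "i \<in> I"
  shows "openin (inv_limit_topology I le X f) {x \<in> inv_limit I le X f. P (x i)}"
proof -
  have c: "continuous_map (inv_limit_topology I le X f) (discrete_topology (X i)) (\<lambda>x. x i)"
    unfolding inv_limit_topology_def
    using continuous_map_product_projection[OF assms]
    by (rule continuous_map_from_subtopology)
  have "openin (inv_limit_topology I le X f)
      {x \<in> topspace (inv_limit_topology I le X f). x i \<in> {y \<in> X i. P y}}"
    by (rule openin_continuous_map_preimage[OF c]) auto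
  moreover have "{x \<in> topspace (inv_limit_topology I le X f). x i \<in> {y \<in> X i. P y}} =
      {x \<in> inv_limit I le X f. P (x i)}"
    using assms unfolding topspace_inv_limit_topology by (auto simp: inv_limit_def)
  ultimately show ?thesis by simp
qed

lemma continuous_map_into_inv_limit:
  assumes "\<And>z. z \<in> topspace Z \<Longrightarrow> g z \<in> inv_limit I le X f"
    and "\<And>i c. i \<in> I \<Longrightarrow> openin Z {z \<in> topspace Z. g z i = c}"
  shows "continuous_map Z (inv_limit_topology I le X f) g"
proof -
  have "continuous_map Z (discrete_topology (X i)) (\<lambda>z. g z i)" if i: "i \<in> I" for i
    unfolding continuous_map_def
  proof (intro conjI allI impI)
    show "(\<lambda>z. g z i) \<in> topspace Z \<rightarrow> topspace (discrete_topology (X i))"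
      using assms(1) i by (auto simp: inv_limit_def)
    fix U
    have "{z \<in> topspace Z. g z i \<in> U} = (\<Union>c\<in>U. {z \<in> topspace Z. g z i = c})" by auto
    also have "openin Z \<dots>" using assms(2)[OF i] by blast
    finally show "openin Z {z \<in> topspace Z. g z i \<in> U}" .
  qed
  then show ?thesis
    unfolding inv_limit_topology_def continuous_map_in_subtopology continuous_map_componentwise
    using assms(1) by (auto simp: inv_limit_def PiE_def)
qed

lemma Hausdorff_inv_limit: "Hausdorff_space (inv_limit_topology I le X f)"
  unfolding inv_limit_topology_def
  by (intro Hausdorff_space_subtopology) (simp add: Hausdorff_space_product_topology)

text \<open>
  Compatibility of two coordinates is a condition on a pair of discrete variables, hence a clopen
  one; this makes the limit closed in the product.
\<close>

lemma compact_inv_limit: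
  assumes "\<And>i. i \<in> I \<Longrightarrow> finite (X i)"
  shows "compact_space (inv_limit_topology I le X f)"
proof -
  let ?P = "product_topology (\<lambda>i. discrete_topology (X i)) I"
  have compact_P: "compact_space ?P"
    using assms by (simp add: compact_space_product_topology compact_space_discrete_topology)
  have op: "openin ?P {x \<in> topspace ?P. x i \<in> U}" if "i \<in> I" for i U
  proof -
    have "openin ?P {x \<in> topspace ?P. x i \<in> U \<inter> X i}"
      by (rule openin_continuous_map_preimage[OF continuous_map_product_projection[OF that]]) simp
    moreover have "{x \<in> topspace ?P. x i \<in> U \<inter> X i} = {x \<in> topspace ?P. x i \<in> U}"
      using that by auto
    ultimately show ?thesis by simp
  qed
  \<comment> \<open>\<open>B (i, j)\<close> consists of the points that violate the compatibility of coordinates \<open>i\<close> and \<open>j\<close>.\<close>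
  define B where "B = (\<lambda>(i, j). \<Union>a. {x \<in> topspace ?P. x j \<in> {a}} \<inter> {x \<in> topspace ?P. x i \<in> - {f i j a}})"
  define W where "W = \<Union> (B ` {(i, j). i \<in> I \<and> j \<in> I \<and> le i j})"
  have "openin ?P (B (i, j))" if "i \<in> I" "j \<in> I" for i j
    unfolding B_def prod.case
    by (rule openin_Union) (use op[OF that(1)] op[OF that(2)] openin_Int in blast)
  then have "openin ?P W" unfolding W_def by blast
  then have "closedin ?P (topspace ?P - W)" by blast
  moreover have "topspace ?P - W = inv_limit I le X f"
    unfolding W_def B_def inv_limit_def by auto
  ultimately have "closedin ?P (inv_limit I le X f)" by simp
  then show ?thesis
    unfolding inv_limit_topology_def using closedin_compact_space[OF compact_P]
    by (simp add: compact_space_subtopology)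
qed

lemma metrizable_inv_limit:
  assumes "countable I"
  shows "metrizable_space (inv_limit_topology I le X f)"
  unfolding inv_limit_topology_def
proof (intro metrizable_space_subtopology)
  have "countable {i \<in> I. \<not> (\<exists>a. topspace (discrete_topology (X i)) \<subseteq> {a})}"
    by (rule countable_subset[OF _ assms]) auto
  then show "metrizable_space (product_topology (\<lambda>i. discrete_topology (X i)) I)"
    unfolding metrizable_space_product_topology by simp
qed

lemma totally_disconnected_inv_limit:
  "totally_disconnected_space (inv_limit_topology I le X f)"
  unfolding totally_disconnected_space_def
proof (intro allI impI)
  let ?T = "inv_limit_topology I le X f"
  fix S assume S: "connectedin ?T S"
  have "x = y" if xy: "x \<in> S" "y \<in> S" for x y
  proof (rule ccontr)
    assume "x \<noteq> y"
    have L: "x \<in> inv_limit I le X f" "y \<in> inv_limit I le X f"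
      using xy connectedin_subset_topspace[OF S] unfolding topspace_inv_limit_topology by auto
    then obtain i where i: "i \<in> I" "x i \<noteq> y i"
      using \<open>x \<noteq> y\<close> PiE_ext[of x I X y] unfolding inv_limit_def by blast
    let ?U = "{z \<in> inv_limit I le X f. z i = x i}"
    have "topspace ?T - ?U = {z \<in> inv_limit I le X f. z i \<noteq> x i}"
      unfolding topspace_inv_limit_topology by auto
    then have "openin ?T (topspace ?T - ?U)"
      using openin_inv_limit_coordinate[OF i(1), of le X f "\<lambda>c. c \<noteq> x i"] by simp
    then have "closedin ?T ?U"
      unfolding closedin_def topspace_inv_limit_topology by auto
    moreover have "openin ?T ?U"
      by (rule openin_inv_limit_coordinate[OF i(1)])
    ultimately have "S \<subseteq> ?U \<or> disjnt S ?U"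
      using connectedin_clopen_cases[OF S] by blast
    then show False using xy L i(2) by (auto simp: disjnt_def)
  qed
  then show "\<exists>x. S \<subseteq> {x}" by blast
qed

lemma totally_disconnected_homeomorphic:
  assumes h: "homeomorphic_map X Y h" and Y: "totally_disconnected_space Y"
  shows "totally_disconnected_space X"
  unfolding totally_disconnected_space_def
proof (intro allI impI)
  fix S assume S: "connectedin X S"
  have sub: "S \<subseteq> topspace X" using S by (rule connectedin_subset_topspace)
  have "connectedin Y (h ` S)" using homeomorphic_map_connectedness[OF h sub] S by simp
  then obtain y where y: "h ` S \<subseteq> {y}" using Y unfolding totally_disconnected_space_def by blast
  have "inj_on h S" using homeomorphic_imp_injective_map[OF h] sub inj_on_subset by blast
  then have "u = v" if "u \<in> S" "v \<in> S" for u v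
    using y that by (auto dest: inj_onD)
  then show "\<exists>x. S \<subseteq> {x}" by blast
qed


section \<open>Balls and reversible arcs\<close>

context wf_digraph
begin

definition out_ball :: "'a set \<Rightarrow> nat \<Rightarrow> 'a set" where
  "out_ball H n = {w. \<exists>u\<in>H. \<exists>\<pi>. awalk u \<pi> w \<and> length \<pi> \<le> n}"

lemma finite_out_ball:
  assumes "row_finite G" "finite H" "H \<subseteq> verts G"
  shows "finite (out_ball H n)"
  using assms(2,3)
proof (induction n arbitrary: H)
  case 0
  have "out_ball H 0 \<subseteq> H" by (auto simp: out_ball_def awalk_Nil_iff)
  then show ?case using 0 finite_subset by blast
next
  case (Suc n)
  let ?H' = "head G ` (\<Union>u\<in>H. out_arcs G u)"
  have "out_ball H (Suc n) \<subseteq> H \<union> out_ball ?H' n"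
  proof
    fix w assume "w \<in> out_ball H (Suc n)"
    then obtain u \<pi> where u: "u \<in> H" "awalk u \<pi> w" "length \<pi> \<le> Suc n"
      by (auto simp: out_ball_def)
    show "w \<in> H \<union> out_ball ?H' n"
    proof (cases \<pi>)
      case Nil
      then show ?thesis using u by (simp add: awalk_Nil_iff)
    next
      case (Cons e es)
      then have "e \<in> out_arcs G u" "awalk (head G e) es w" "length es \<le> n"
        using u by (auto simp: awalk_Cons_iff)
      then show ?thesis using u(1) by (auto simp: out_ball_def)
    qed
  qed
  moreover have "finite ?H'" using Suc.prems assms(1) by (auto simp: row_finite_def)
  moreover have "?H' \<subseteq> verts G" by auto
  ultimately show ?case using Suc by (meson finite_UnI finite_subset)
qed

lemma out_ball_superset: "H \<subseteq> verts G \<Longrightarrow> H \<subseteq> out_ball H n"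
proof
  fix u assume "H \<subseteq> verts G" "u \<in> H"
  then have "awalk u [] u \<and> length ([] :: 'b list) \<le> n" by (auto simp: awalk_Nil_iff)
  then show "u \<in> out_ball H n" using \<open>u \<in> H\<close> unfolding out_ball_def by blast
qed

lemma out_ball_in_verts: "out_ball H n \<subseteq> verts G"
  by (auto simp: out_ball_def)

text \<open>
  A return walk of length at most \<open>N\<close> that met \<open>H\<close> would put the tail of the arc within
  distance \<open>N\<close> of \<open>H\<close>. So an arc that starts outside the ball of radius \<open>N\<close> around \<open>H\<close> can be
  undone without touching \<open>H\<close>.
\<close>

lemma arc_reversible_off:
  assumes "\<exists>\<pi>. awalk (head G a) \<pi> (tail G a) \<and> length \<pi> \<le> N" and "tail G a \<notin> out_ball H N"
  shows "leaving_paths G H (head G a) (tail G a) \<noteq> {}"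
proof -
  obtain \<pi> where \<pi>: "awalk (head G a) \<pi> (tail G a)" "length \<pi> \<le> N" using assms(1) by blast
  have "head G b \<notin> H" if b: "b \<in> set \<pi>" for b
  proof
    assume H: "head G b \<in> H"
    obtain \<pi>1 \<pi>2 where s: "\<pi> = \<pi>1 @ b # \<pi>2" using b by (meson split_list)
    then have "awalk (head G b) \<pi>2 (tail G a)" using \<pi>(1) by (auto simp: awalk_Cons_iff)
    moreover have "length \<pi>2 \<le> N" using s \<pi>(2) by simp
    ultimately show False using H assms(2) by (auto simp: out_ball_def)
  qed
  then show ?thesis using \<pi>(1) by (auto simp: leaving_paths_def)
qed

text \<open>
  Along an undirected path off the ball, the arcs traversed backwards are replaced by their
  return walks.
\<close>

lemma component_rel_joined_off:
  assumes ret: "\<And>a. a \<in> arcs G \<Longrightarrow> \<exists>\<pi>. awalk (head G a) \<pi> (tail G a) \<and> length \<pi> \<le> N"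
    and H: "H \<subseteq> verts G" and K: "out_ball H N \<subseteq> K"
    and uv: "(u, v) \<in> component_rel (remove_verts G K)"
  shows "joined_off H u v"
proof -
  let ?R = "arcs_ends (remove_verts G K)"
  have HK: "H \<subseteq> K" using out_ball_superset[OF H] K by blast
  have u: "u \<in> verts G - K" "(u, v) \<in> (?R \<union> ?R\<inverse>)\<^sup>*"
    using uv by (auto simp: component_rel_def remove_verts_def)
  have "leaving_paths G H u v \<noteq> {}" using u(2)
  proof (induction rule: rtrancl_induct)
    case base
    have "[] \<in> leaving_paths G H u u" using u(1) by (simp add: leaving_paths_def awalk_Nil_iff)
    then show ?case by blast
  next
    case (step y z)
    have "leaving_paths G H y z \<noteq> {}" using step.hyps(2)
    proof
      assume "(y, z) \<in> ?R"
      then obtain a where a: "a \<in> arcs G" "tail G a = y" "head G a = z" "z \<notin> K"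
        by (auto simp: arcs_ends_conv remove_verts_def)
      then have "[a] \<in> leaving_paths G H y z"
        using HK by (auto simp: leaving_paths_def awalk_Cons_iff awalk_Nil_iff)
      then show ?thesis by blast
    next
      assume "(y, z) \<in> ?R\<inverse>"
      then obtain a where a: "a \<in> arcs G" "tail G a = z" "head G a = y" "z \<notin> K"
        by (auto simp: arcs_ends_conv remove_verts_def)
      then show ?thesis using arc_reversible_off[OF ret, of a H] K by blast
    qed
    then show ?case using step.IH leaving_paths_trans by blast
  qed
  then show ?thesis using u(1) HK unfolding joined_off_iff by blast
qed

lemma last_exit:
  assumes "awalk u \<pi> w" "u \<in> H"
  shows "\<exists>v\<in>H. leaving_paths G H v w \<noteq> {}"
proof -
  have "leaving_paths G H u w \<noteq> {} \<or> (\<exists>v\<in>H. leaving_paths G H v w \<noteq> {})" using assms(1)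
  proof (induction \<pi> arbitrary: u)
    case Nil
    then have "[] \<in> leaving_paths G H u w" by (simp add: leaving_paths_def)
    then show ?case by blast
  next
    case (Cons e es)
    then have e: "e \<in> arcs G" "u = tail G e" "awalk (head G e) es w"
      by (auto simp: awalk_Cons_iff)
    then have "[e] \<in> leaving_paths G H u (head G e)" if "head G e \<notin> H"
      using that by (auto simp: leaving_paths_def awalk_Cons_iff awalk_Nil_iff)
    then show ?case using Cons.IH[OF e(3)] leaving_paths_trans by blast
  qed
  then show ?thesis using assms(2) by blast
qed

lemma leaving_path_first_step:
  assumes "leaving_paths G H v w \<noteq> {}" "v \<in> H" "w \<notin> H"
  obtains a where "a \<in> out_arcs G v" "head G a \<notin> H" "leaving_paths G H (head G a) w \<noteq> {}"
proof -
  obtain \<pi> where \<pi>: "awalk v \<pi> w" "\<forall>a\<in>set \<pi>. head G a \<notin> H"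
    using assms(1) by (auto simp: leaving_paths_def)
  then obtain a \<pi>' where s: "\<pi> = a # \<pi>'" using assms(2,3) by (cases \<pi>) (auto simp: awalk_Nil_iff)
  then have "\<pi>' \<in> leaving_paths G H (head G a) w"
    using \<pi> by (auto simp: leaving_paths_def awalk_Cons_iff)
  moreover have "a \<in> out_arcs G v" "head G a \<notin> H" using \<pi> s by (auto simp: awalk_Cons_iff)
  ultimately show thesis using that by blast
qed


section \<open>Concatenating infinitely many walks\<close>

text \<open>
  The concatenation is read off a machine whose state records the number of the current walk and
  the part of it that has not been used yet; \<open>s i\<close> is the number of the walk that the arc \<open>p i\<close>
  comes from.
\<close>

lemma concatenate_walks:
  assumes W: "\<And>n. awalk (w n) (W n) (w (Suc n))" and ne: "\<And>n. W n \<noteq> []"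
  obtains p s where "p \<in> inf_paths G" "mono (s :: nat \<Rightarrow> nat)" "\<And>i. p i \<in> set (W (s i))"
    "\<And>m. \<exists>i. s i = m \<and> tail G (p i) = w m"
proof -
  define step where
    "step = (\<lambda>(n, xs). if tl xs = [] then (Suc n, W (Suc n)) else (n, tl xs))"
  define st where "st i = (step ^^ i) (0, W 0)" for i
  define s where "s i = fst (st i)" for i
  define r where "r i = snd (st i)" for i
  define p where "p i = hd (r i)" for i
  have st: "st i = (s i, r i)" for i by (simp add: s_def r_def)
  have st0: "st 0 = (0, W 0)" by (simp add: st_def)
  have stS: "st (Suc i) = (if tl (r i) = [] then (Suc (s i), W (Suc (s i))) else (s i, tl (r i)))" for i
  proof -
    have "st (Suc i) = step (st i)" by (simp add: st_def)
    then show ?thesis by (simp add: st[of i] step_def)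
  qed
  have tl0: "tail G (hd (W n)) = w n" for n
    using W[of n] ne[of n] by (cases "W n") (auto simp: awalk_Cons_iff)
  have inv: "r i \<noteq> [] \<and> set (r i) \<subseteq> set (W (s i)) \<and> awalk (tail G (p i)) (r i) (w (Suc (s i)))" for i
  proof (induction i)
    case 0
    then show ?case using W[of 0] ne[of 0] tl0[of 0] st0 by (simp add: st p_def)
  next
    case (Suc i)
    then obtain a xs where a: "r i = a # xs" by (meson list.exhaust)
    show ?case
    proof (cases xs)
      case Nil
      then have "s (Suc i) = Suc (s i)" "r (Suc i) = W (Suc (s i))"
        using stS[of i] a by (auto simp: st)
      then show ?thesis using W[of "Suc (s i)"] ne tl0[of "Suc (s i)"] by (simp add: p_def)
    next
      case (Cons b ys)
      then have "s (Suc i) = s i" "r (Suc i) = b # ys"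
        using stS[of i] a by (auto simp: st)
      then show ?thesis using Suc a Cons by (auto simp: p_def awalk_Cons_iff)
    qed
  qed
  have "p i \<in> arcs G \<and> head G (p i) = tail G (p (Suc i))" for i
  proof -
    obtain a xs where a: "r i = a # xs" using inv[of i] by (meson list.exhaust)
    then have aw: "a \<in> arcs G" "awalk (head G a) xs (w (Suc (s i)))"
      using inv[of i] by (auto simp: awalk_Cons_iff)
    show ?thesis
    proof (cases xs)
      case Nil
      then have "r (Suc i) = W (Suc (s i))" using stS[of i] a by (auto simp: st)
      then show ?thesis using a aw Nil tl0 by (simp add: p_def awalk_Nil_iff)
    next
      case (Cons b ys)
      then have "r (Suc i) = b # ys" using stS[of i] a by (auto simp: st)
      then show ?thesis using a aw Cons by (simp add: p_def awalk_Cons_iff)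
    qed
  qed
  then have "p \<in> inf_paths G" by (simp add: inf_paths_def)
  moreover have "mono s"
    unfolding mono_iff_le_Suc using stS by (auto simp: s_def)
  moreover have "p i \<in> set (W (s i))" for i
    using inv[of i] by (auto simp: p_def)
  moreover have "\<exists>i. s i = m \<and> tail G (p i) = w m" for m
  proof -
    have fin: "\<exists>j. st j = (Suc m, W (Suc m))" if "st i = (m, xs)" "xs \<noteq> []" for i m xs
      using that
    proof (induction xs arbitrary: i)
      case (Cons a xs)
      then have "s i = m" "r i = a # xs" by (auto simp: st)
      then have "st (Suc i) = (if xs = [] then (Suc m, W (Suc m)) else (m, xs))"
        using stS[of i] by simp
      then show ?case using Cons.IH[of "Suc i"] by (cases "xs = []") auto
    qed simp
    have "\<exists>i. st i = (m, W m)"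
      by (induction m) (use st0 fin ne in blast)+
    then show ?thesis using tl0 by (auto simp: st p_def)
  qed
  ultimately show thesis using that by blast
qed

end


section \<open>Ends and components\<close>

locale exhausted_digraph = wf_digraph G for G :: "('v, 'e) pre_digraph" +
  fixes v0 :: 'v and D :: "nat \<Rightarrow> 'v set"
  assumes strong: "strongly_connected G"
    and almost_undir: "almost_undirected G"
    and row_fin: "row_finite G"
    and exh: "exhaustion G v0 D"
begin

lemmas D_finite = exhaustionD(1)[OF exh] and D_verts = exhaustionD(2)[OF exh]

lemma D_mono: "1 \<le> n \<Longrightarrow> n \<le> j \<Longrightarrow> D n \<subseteq> D j"
proof (induction j)
  case (Suc j)
  then show ?case using exhaustionD(3)[OF exh, of j] by (cases "n = Suc j") auto
qed simp

lemma v0_in: "v0 \<in> verts G" "1 \<le> n \<Longrightarrow> v0 \<in> D n"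
proof -
  have "v0 \<in> D 1" using exh by (auto simp: exhaustion_def well_inside_def Int_verts_def)
  then show "v0 \<in> verts G" "1 \<le> n \<Longrightarrow> v0 \<in> D n" using D_verts[of 1] D_mono[of 1 n] by auto
qed

lemma D_fin_parts: "1 \<le> n \<Longrightarrow> D n \<in> fin_parts G"
  using D_finite D_verts v0_in(2) unfolding fin_parts_def by blast

lemma head_in_next_D: "1 \<le> n \<Longrightarrow> v \<in> D n \<Longrightarrow> a \<in> out_arcs G v \<Longrightarrow> head G a \<in> D (Suc n)"
  using exh by (fastforce simp: exhaustion_def well_inside_def Int_verts_def)

lemma finite_subset_D:
  assumes "finite F" "F \<subseteq> verts G"
  obtains n where "n \<ge> m" "n \<ge> 1" "F \<subseteq> D n"
proof -
  have "\<exists>n\<ge>max m 1. F \<subseteq> D n" using assms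
  proof (induction F)
    case (insert x F)
    then obtain n where n: "n \<ge> max m 1" "F \<subseteq> D n" by auto
    obtain k where k: "k \<ge> 1" "x \<in> D k"
      using insert.prems exh unfolding exhaustion_def by (metis UN_E atLeast_iff insert_subset)
    have "D n \<subseteq> D (max n k)" "D k \<subseteq> D (max n k)" using n k by (simp_all add: D_mono)
    then show ?case using n k by (intro exI[of _ "max n k"]) auto
  qed (auto intro: exI[of _ "max m 1"])
  then show thesis using that by auto
qed

lemma tail_in_verts: "p \<in> Wan G \<Longrightarrow> tail G (p i) \<in> verts G"
  by (auto simp: Wan_def inf_paths_def)

lemma walk_exists: "u \<in> verts G \<Longrightarrow> v \<in> verts G \<Longrightarrow> \<exists>\<pi>. awalk u \<pi> v"
  using strong reachable_awalk by (auto simp: strongly_connected_def)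

abbreviation component_off :: "nat \<Rightarrow> 'v \<Rightarrow> 'v set" where
  "component_off n \<equiv> component_at (remove_verts G (D n))"

text \<open>
  For large \<open>n\<close> the set \<open>D n\<close> contains the ball around \<open>H\<close> whose radius is the bound on the length
  of the return walks.
\<close>

lemma components_strongly_joined:
  assumes H: "finite H" "H \<subseteq> verts G"
  obtains n where "n \<ge> m" "n \<ge> 1" "H \<subseteq> D n"
    "\<And>u v. (u, v) \<in> component_rel (remove_verts G (D n)) \<Longrightarrow> joined_off H u v"
proof -
  obtain N where N: "\<And>a. a \<in> arcs G \<Longrightarrow> \<exists>\<pi>. awalk (head G a) \<pi> (tail G a) \<and> length \<pi> \<le> N"
    using almost_undir unfolding almost_undirected_def by blast
  obtain n where n: "n \<ge> m" "n \<ge> 1" "out_ball H N \<subseteq> D n"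
    using finite_subset_D[OF finite_out_ball[OF row_fin H] out_ball_in_verts] .
  show thesis
    by (rule that[of n]) (use n out_ball_superset[OF H(2)] component_rel_joined_off[OF N H(2)] in auto)
qed

lemma comp_eq_iff:
  assumes "v \<in> verts G - D n"
  shows "component_off n u = component_off n v \<longleftrightarrow> (u, v) \<in> component_rel (remove_verts G (D n))"
proof
  have "v \<in> component_off n v"
    unfolding component_at_def
    using assms by (intro equiv_class_self[OF equiv_component_rel]) (simp add: remove_verts_def)
  then show "component_off n u = component_off n v \<Longrightarrow> (u, v) \<in> component_rel (remove_verts G (D n))"
    by (auto simp: component_at_def)
qed (rule component_at_eq)

lemma rho_path_tail:
  assumes "p \<in> Wan G" "n \<ge> 1" "i \<ge> off_index (D n) p"
  shows "rho_path G D p n = component_off n (tail G (p i))"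
  using component_at_tail_const[OF assms(1) off_index[OF assms(1) D_finite D_verts] assms(3)] assms(2)
  by (simp add: rho_path_eq(1)[OF exh assms(1)])

lemma rho_path_agree:
  assumes p: "p \<in> Wan G" and q: "q \<in> Wan G" and n: "n \<ge> 1"
    and eq: "rho_path G D p n = rho_path G D q n"
    and i: "i \<ge> off_index (D n) p" and j: "j \<ge> off_index (D n) q"
  shows "(tail G (p i), tail G (q j)) \<in> component_rel (remove_verts G (D n))"
proof -
  have "tail G (q j) \<in> verts G - D n"
    using off_index[OF q D_finite[OF n] D_verts[OF n] j] tail_in_verts[OF q] by blast
  then show ?thesis
    using eq rho_path_tail[OF p n i] rho_path_tail[OF q n j] comp_eq_iff by metis
qed

text \<open>
  If two paths end up in the same component off \<open>D n\<close>, then a walk that leaves \<open>H\<close> for good and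
  reaches the first path can be prolonged off \<open>H\<close> to the second one.
\<close>

lemma end_trace_determined_by_rho:
  assumes H: "H \<in> fin_parts G"
  obtains n where "n \<ge> 1" "\<And>p q. p \<in> Wan G \<Longrightarrow> q \<in> Wan G \<Longrightarrow>
    rho_path G D p n = rho_path G D q n \<Longrightarrow> end_trace G H p = end_trace G H q"
proof -
  obtain n where n: "n \<ge> 1" "H \<subseteq> D n"
    and join: "\<And>u v. (u, v) \<in> component_rel (remove_verts G (D n)) \<Longrightarrow> joined_off H u v"
    using components_strongly_joined[of H 0] H by (auto simp: fin_parts_def)
  have sub: "end_trace G H p \<subseteq> end_trace G H q"
    if p: "p \<in> Wan G" and q: "q \<in> Wan G" and eq: "rho_path G D p n = rho_path G D q n" for p q
  proof
    fix v assume v: "v \<in> end_trace G H p"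
    then obtain i where i: "i \<ge> off_index (D n) p" "leaving_paths G H v (tail G (p i)) \<noteq> {}"
      unfolding end_trace_def by blast
    have "tail G (q j) \<notin> H \<and> leaving_paths G H v (tail G (q j)) \<noteq> {}"
      if j: "j \<ge> off_index (D n) q" for j
    proof
      show "tail G (q j) \<notin> H"
        using off_index[OF q D_finite[OF n(1)] D_verts[OF n(1)] j] n(2) by blast
      show "leaving_paths G H v (tail G (q j)) \<noteq> {}"
        using join[OF rho_path_agree[OF p q n(1) eq i(1) j]] i(2) leaving_paths_trans
        unfolding joined_off_iff by blast
    qed
    then have "\<forall>M. \<exists>j\<ge>M. tail G (q j) \<notin> H \<and> leaving_paths G H v (tail G (q j)) \<noteq> {}"
      by (meson nat_le_linear order_refl)
    then show "v \<in> end_trace G H q" using v unfolding end_trace_def by blast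
  qed
  show thesis by (rule that[OF n(1)]) (intro equalityI sub; simp)
qed

text \<open>The trace is inhabited because a walk from \<open>v0\<close> to a late vertex of \<open>p\<close> has a last vertex in \<open>D n\<close>.\<close>

lemma end_trace_nonempty:
  assumes p: "p \<in> Wan G" and n: "n \<ge> 1"
  shows "end_trace G (D n) p \<noteq> {}"
proof -
  let ?k = "off_index (D n) p"
  note off = off_index[OF p D_finite[OF n] D_verts[OF n]]
  obtain \<pi> where "awalk v0 \<pi> (tail G (p ?k))"
    using walk_exists v0_in(1) tail_in_verts[OF p] by blast
  then obtain v where v: "v \<in> D n" "leaving_paths G (D n) v (tail G (p ?k)) \<noteq> {}"
    using last_exit v0_in(2)[OF n] by blast
  have "leaving_paths G (D n) v (tail G (p j)) \<noteq> {}" if "j \<ge> ?k" for j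
    using leaving_paths_trans[OF v(2) segment[OF Wan_inf_paths[OF p] off that]] by simp
  then have "\<forall>N. \<exists>j\<ge>N. tail G (p j) \<notin> D n \<and> leaving_paths G (D n) v (tail G (p j)) \<noteq> {}"
    using off by (meson nat_le_linear order_refl)
  then show ?thesis using v(1) unfolding end_trace_def by blast
qed

text \<open>
  An arc from \<open>D n\<close> ends in \<open>D (Suc n)\<close>, so a path from \<open>D n\<close> cannot escape without meeting
  \<open>D (Suc n)\<close> after its start. The trace on \<open>D (Suc n)\<close> therefore consists of vertices
  outside \<open>D n\<close>, and these lie in the component of the end.
\<close>

lemma end_trace_in_component:
  assumes p: "p \<in> Wan G" and n: "n \<ge> 1" and v: "v \<in> end_trace G (D (Suc n)) p"
  shows "rho_path G D p n = component_off n v"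
proof -
  obtain i where i: "i \<ge> off_index (D n) p" "tail G (p i) \<notin> D (Suc n)"
    and l: "leaving_paths G (D (Suc n)) v (tail G (p i)) \<noteq> {}"
    using v unfolding end_trace_def by blast
  have vD: "v \<in> D (Suc n)" using v by (simp add: end_trace_def)
  have "v \<notin> D n"
  proof
    assume "v \<in> D n"
    obtain a where a: "a \<in> out_arcs G v" "head G a \<notin> D (Suc n)"
      using leaving_path_first_step[OF l vD i(2)] by blast
    show False using head_in_next_D[OF n \<open>v \<in> D n\<close> a(1)] a(2) by contradiction
  qed
  then have "(v, tail G (p i)) \<in> component_rel (remove_verts G (D n))"
    by (intro leaving_paths_component leaving_paths_mono[OF exhaustionD(3)[OF exh n] l])
  then show ?thesis using rho_path_tail[OF p n i(1)] component_at_eq by metis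
qed

lemma rho_determined_by_end_trace:
  assumes "p \<in> Wan G" "q \<in> Wan G" "n \<ge> 1"
    and "end_trace G (D (Suc n)) p = end_trace G (D (Suc n)) q"
  shows "rho_path G D p n = rho_path G D q n"
proof -
  obtain v where "v \<in> end_trace G (D (Suc n)) p"
    using end_trace_nonempty[OF assms(1), of "Suc n"] by auto
  then show ?thesis using end_trace_in_component assms by metis
qed

lemma same_end_if_rho_eq:
  assumes p: "p \<in> Wan G" and q: "q \<in> Wan G" and eq: "rho_path G D p = rho_path G D q"
  shows "(p, q) \<in> same_end G"
proof -
  have "leads_to G p q" if p: "p \<in> Wan G" and q: "q \<in> Wan G"
    and eq: "rho_path G D p = rho_path G D q" for p q
    unfolding leads_to_iff
  proof (intro allI impI)
    fix H N assume "finite H \<and> H \<subseteq> verts G"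
    then have H: "finite H" "H \<subseteq> verts G" by auto
    obtain n where n: "n \<ge> 1"
      and join: "\<And>u v. (u, v) \<in> component_rel (remove_verts G (D n)) \<Longrightarrow> joined_off H u v"
      using components_strongly_joined[OF H, of 0] by metis
    let ?i = "max N (off_index (D n) p)" and ?j = "max N (off_index (D n) q)"
    have "joined_off H (tail G (p ?i)) (tail G (q ?j))"
      by (rule join[OF rho_path_agree[OF p q n fun_cong[OF eq] max.cobounded2 max.cobounded2]])
    then show "\<exists>n1\<ge>N. \<exists>n2\<ge>N. joined_off H (tail G (p n1)) (tail G (q n2))"
      by (intro exI[of _ ?i] exI[of _ ?j] conjI max.cobounded1)
  qed
  then show ?thesis using assms by (simp add: same_end_def)
qed

text \<open>
  The components of a thread are nested, so a vertex of the one at level \<open>n\<close> represents those at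
  all lower levels.
\<close>

lemma C_inf_component:
  assumes x: "x \<in> C_inf G D" and n: "n \<ge> 1"
  obtains v where "v \<in> x n"
    and "\<And>u m. u \<in> x n \<Longrightarrow> 1 \<le> m \<Longrightarrow> m \<le> n \<Longrightarrow> u \<in> verts G - D m \<and> x m = component_off m u"
proof -
  have comps: "x m \<in> components_of (remove_verts G (D m))" if "m \<ge> 1" for m
    using x that by (auto simp: C_inf_def inv_limit_def)
  have bond: "C_bond G D m (Suc m) (x (Suc m)) = x m" if "m \<ge> 1" for m
    using x that by (auto simp: C_inf_def inv_limit_def)
  have eqv: "equiv (verts G - D m) (component_rel (remove_verts G (D m)))" for m
    using equiv_component_rel[of "remove_verts G (D m)"] by (simp add: remove_verts_def)
  have comps': "x m \<in> (verts G - D m) // component_rel (remove_verts G (D m))" if "m \<ge> 1" for m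
    using comps[OF that] by (simp add: components_of_def remove_verts_def)
  have self: "u \<in> verts G - D m \<and> x m = component_off m u" if "m \<ge> 1" "u \<in> x m" for u m
  proof
    show "u \<in> verts G - D m" using in_quotient_imp_subset[OF eqv comps'] that by blast
    show "x m = component_off m u"
      using comps'[OF that(1)] equiv_class_eq[OF eqv, of _ u] that(2)
      unfolding component_at_def by (auto elim!: quotientE)
  qed
  have "u \<in> verts G - D m \<and> x m = component_off m u" if u: "u \<in> x n" and "1 \<le> m" "m \<le> n" for u m
    using \<open>m \<le> n\<close> \<open>1 \<le> m\<close>
  proof (induction m rule: inc_induct)
    case base
    then show ?case using self u by blast
  next
    case (step m)
    then have S: "u \<in> verts G - D (Suc m)" "x (Suc m) = component_off (Suc m) u" by auto
    have sub: "D m \<subseteq> D (Suc m)" using exhaustionD(3)[OF exh] step by blast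
    have "x m = component_off m u"
      using C_bond_component_at[of D m "Suc m" u, OF sub S(1)] bond[of m] S(2) step.prems by simp
    then show ?case using S(1) sub by blast
  qed
  moreover have "x n \<noteq> {}" using in_quotient_imp_non_empty[OF eqv comps'[OF n]] .
  ultimately show thesis using that by blast
qed

text \<open>
  Choose a vertex in each component of the given thread. If \<open>f (Suc n)\<close> is so large that
  components off \<open>D (f (Suc n))\<close> are strongly joined off \<open>D (f n)\<close>, then consecutive chosen
  vertices are joined by directed walks that avoid larger and larger sets, and the
  concatenation of these walks is a wandering path with the given components.
\<close>

lemma rho_surjective:
  assumes x: "x \<in> C_inf G D"
  obtains p where "p \<in> Wan G" "rho_path G D p = x"
proof -
  have "\<forall>n. \<exists>u. n \<ge> 1 \<longrightarrow> u \<in> x n" using C_inf_component[OF x] by metis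
  then obtain v where v: "\<And>n. n \<ge> 1 \<Longrightarrow> v n \<in> x n" by metis
  have below: "u \<in> verts G - D m \<and> x m = component_off m u" if "u \<in> x n" "1 \<le> m" "m \<le> n" for u m n
    using C_inf_component[OF x, of n] that by (metis order_trans)
  have "\<exists>k. n \<ge> 1 \<longrightarrow> k > n \<and> v n \<in> D k \<and>
      (\<forall>u u'. (u, u') \<in> component_rel (remove_verts G (D k)) \<longrightarrow> joined_off (D n) u u')" for n
  proof (cases "n \<ge> 1")
    case True
    have "{v n} \<subseteq> verts G" using below[OF v[OF True] True order_refl] by simp
    then obtain k1 where k1: "k1 \<ge> Suc n" "k1 \<ge> 1" "{v n} \<subseteq> D k1"
      using finite_subset_D[of "{v n}" "Suc n"] by blast
    obtain k where k: "k \<ge> k1" "k \<ge> 1"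
      "\<And>u u'. (u, u') \<in> component_rel (remove_verts G (D k)) \<Longrightarrow> joined_off (D n) u u'"
      using components_strongly_joined[OF D_finite[OF True] D_verts[OF True]] by metis
    then show ?thesis using k1 D_mono[OF k1(2) k(1)] by (intro exI[of _ k]) auto
  qed auto
  then obtain g where g: "\<And>n. n \<ge> 1 \<Longrightarrow> g n > n \<and> v n \<in> D (g n) \<and>
      (\<forall>u u'. (u, u') \<in> component_rel (remove_verts G (D (g n))) \<longrightarrow> joined_off (D n) u u')"
    by metis
  define f where "f n = (g ^^ n) 1" for n
  have fS: "f (Suc n) = g (f n)" for n by (simp add: f_def)
  have fge: "f n \<ge> Suc n" for n
  proof (induction n)
    case (Suc n)
    then show ?case using g[of "f n"] fS[of n] by simp
  qed (simp add: f_def)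
  have f1: "f n \<ge> 1" for n using fge[of n] by simp
  have fless: "f n < f (Suc n)" for n using g[OF f1] fS by simp
  \<comment> \<open>The shift by one puts \<open>w n\<close> and \<open>w (Suc n)\<close> into the same component off \<open>D (f (Suc n))\<close>, which
    joins them off \<open>D (f n)\<close>.\<close>
  define w where "w n = v (f (Suc n))" for n
  have w_in: "w n \<in> x (f (Suc n))" for n using v f1 by (simp add: w_def)
  have "\<exists>\<pi>. awalk (w n) \<pi> (w (Suc n)) \<and> set (awalk_verts (w n) \<pi>) \<inter> D (f n) = {} \<and> \<pi> \<noteq> []" for n
  proof -
    let ?m = "f (Suc n)"
    have a: "w n \<in> verts G - D ?m" "x ?m = component_off ?m (w n)" using below[OF w_in f1 order_refl] by auto
    have b: "w (Suc n) \<in> verts G - D ?m" "x ?m = component_off ?m (w (Suc n))"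
      using below[OF w_in[of "Suc n"] f1] fless[of "Suc n"] by (auto simp: less_imp_le)
    have "(w n, w (Suc n)) \<in> component_rel (remove_verts G (D ?m))"
      using comp_eq_iff[OF b(1), of "w n"] a b by simp
    then have "joined_off (D (f n)) (w n) (w (Suc n))" using g[OF f1] fS by metis
    then obtain \<pi> where \<pi>: "awalk (w n) \<pi> (w (Suc n))" "set (awalk_verts (w n) \<pi>) \<inter> D (f n) = {}"
      unfolding joined_off_def by blast
    \<comment> \<open>The vertices are distinct, so the walk is not empty: \<open>g\<close> was chosen so that the next
      set swallows the present vertex.\<close>
    have "w n \<in> D (f (Suc (Suc n)))" using g[OF f1, of "Suc n"] fS by (simp add: w_def)
    moreover have "w (Suc n) \<notin> D (f (Suc (Suc n)))" using below[OF w_in f1 order_refl] by blast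
    ultimately have "\<pi> \<noteq> []" using \<pi>(1) by (auto simp: awalk_Nil_iff)
    then show ?thesis using \<pi> by blast
  qed
  then obtain W where W: "\<And>n. awalk (w n) (W n) (w (Suc n))" "\<And>n. W n \<noteq> []"
    and W_off: "\<And>n. set (awalk_verts (w n) (W n)) \<inter> D (f n) = {}"
    by metis
  obtain p s where p: "p \<in> inf_paths G" and s: "mono s"
    and ps: "\<And>i. p i \<in> set (W (s i))" and start: "\<And>m. \<exists>i. s i = m \<and> tail G (p i) = w m"
    using concatenate_walks[of w W] W by metis
  have off: "tail G (p i) \<notin> D (f (s i))" for i
    using W_off[of "s i"] awalk_verts_arc1[OF ps] by blast
  have wan: "p \<in> Wan G"
  proof -
    have "\<exists>N. \<forall>i\<ge>N. tail G (p i) \<notin> H" if H: "finite H" "H \<subseteq> verts G" for H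
    proof -
      obtain k where k: "k \<ge> 1" "H \<subseteq> D k" using finite_subset_D[OF H] by blast
      obtain i0 where i0: "s i0 = k" using start by blast
      have "tail G (p i) \<notin> H" if "i \<ge> i0" for i
      proof -
        have "k \<le> f (s i)" using monoD[OF s that] i0 fge[of "s i"] by simp
        then show ?thesis using off[of i] D_mono[OF k(1)] k(2) by blast
      qed
      then show ?thesis by blast
    qed
    then show ?thesis using p by (simp add: Wan_def)
  qed
  have "rho_path G D p n = x n" if n: "n \<ge> 1" for n
  proof -
    let ?k = "off_index (D n) p"
    \<comment> \<open>The walk of number \<open>s i\<close> starts after the last visit of \<open>p\<close> to \<open>D n\<close>, and \<open>s i \<ge> n\<close> ensures
      that its initial vertex represents \<open>x n\<close>.\<close>
    obtain i where i: "s i = max n (Suc (s ?k))" "tail G (p i) = w (s i)" using start by metis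
    have "?k \<le> i"
    proof (rule ccontr)
      assume "\<not> ?k \<le> i"
      then have "s i \<le> s ?k" using monoD[OF s, of i ?k] by simp
      then show False using i(1) by simp
    qed
    then have "rho_path G D p n = component_off n (w (s i))" using rho_path_tail[OF wan n] i(2) by simp
    also have "\<dots> = x n"
      using below[OF w_in n, of "s i"] fge[of "Suc (s i)"] i(1) by simp
    finally show ?thesis .
  qed
  moreover have "rho_path G D p \<in> C_inf G D" by (rule rho_path_eq(2)[OF exh wan])
  ultimately have "rho_path G D p = x"
    using x by (intro PiE_ext[of _ "{1..}" "\<lambda>n. components_of (remove_verts G (D n))"])
      (auto simp: C_inf_def inv_limit_def)
  then show thesis using that wan by blast
qed

text \<open>
  Every component off \<open>D n\<close> contains a vertex of \<open>D (Suc n)\<close>: a walk into it from \<open>v0\<close> leaves \<open>D n\<close>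
  for the last time through an arc that ends there.
\<close>

lemma finite_components:
  assumes n: "n \<ge> 1"
  shows "finite (components_of (remove_verts G (D n)))"
proof (rule finite_subset)
  show "components_of (remove_verts G (D n)) \<subseteq> component_off n ` D (Suc n)"
  proof
    fix c assume "c \<in> components_of (remove_verts G (D n))"
    then obtain u where u: "u \<in> verts G" "u \<notin> D n" "c = component_off n u"
      unfolding components_of_def component_at_def by (auto elim!: quotientE simp: remove_verts_def)
    obtain \<pi> where "awalk v0 \<pi> u" using walk_exists v0_in u by blast
    then obtain v where v: "v \<in> D n" "leaving_paths G (D n) v u \<noteq> {}"
      using last_exit v0_in(2)[OF n] by blast
    obtain a where a: "a \<in> out_arcs G v" "head G a \<notin> D n"
      "leaving_paths G (D n) (head G a) u \<noteq> {}"
      using leaving_path_first_step[OF v(2,1) u(2)] by blast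
    have "c = component_off n (head G a)"
      using component_at_eq[OF leaving_paths_component[OF a(3,2)]] u by simp
    then show "c \<in> component_off n ` D (Suc n)" using head_in_next_D[OF n v(1) a(1)] by blast
  qed
  show "finite (component_off n ` D (Suc n))" using D_finite[of "Suc n"] by simp
qed


section \<open>The homeomorphisms\<close>

lemma topspace_ends: "topspace (end_topology G) = end_of G ` Wan G"
proof -
  have "verts G \<noteq> {}" using v0_in by blast
  from topspace_end_topology[OF this] show ?thesis
    by (auto simp: Ends_def end_of_def quotient_def)
qed

lemma end_of_eq: "(p, q) \<in> same_end G \<Longrightarrow> end_of G p = end_of G q"
  unfolding end_of_def by (rule equiv_class_eq[OF equiv_same_end])

lemma openin_basic:
  assumes "H \<in> fin_parts G" "I \<subseteq> H"
  shows "openin (end_topology G) {end_of G p |p. p \<in> Wan G \<and> end_trace G H p = I}"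
  unfolding openin_end_topology
  by (rule arbitrary_union_of_inc) (use assms in \<open>auto simp: end_base_def\<close>)

lemma chi_at: "p \<in> Wan G \<Longrightarrow> H \<in> fin_parts G \<Longrightarrow> chi G (end_of G p) H = end_trace G H p"
  by (simp add: chi_end_of)

lemma openin_chi:
  assumes "H \<in> fin_parts G"
  shows "openin (end_topology G) {e \<in> topspace (end_topology G). chi G e H = I}"
proof -
  have eq: "{e \<in> topspace (end_topology G). chi G e H = I} =
      {end_of G p |p. p \<in> Wan G \<and> end_trace G H p = I}"
    unfolding topspace_ends using chi_at assms by auto
  show ?thesis
  proof (cases "I \<subseteq> H")
    case True
    then show ?thesis unfolding eq by (rule openin_basic[OF assms])
  next
    case False
    then have "{end_of G p |p. p \<in> Wan G \<and> end_trace G H p = I} = {}"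
      by (auto simp: end_trace_def)
    then show ?thesis unfolding eq by (simp only: openin_empty)
  qed
qed

text \<open>
  Both topologies are described by finite data, and these determine each other: fixing the trace
  on \<open>D (Suc n)\<close> fixes coordinate \<open>n\<close> of \<open>\<rho>\<close>, which gives continuity; fixing a suitable coordinate
  of \<open>\<rho>\<close> fixes the trace on a given \<open>H\<close>, which gives openness.
\<close>

lemma homeomorphic_rho: "homeomorphic_map (end_topology G) (C_inf_topology G D) (rho G D)"
proof (rule bijective_open_imp_homeomorphic_map)
  let ?E = "end_topology G" and ?C = "C_inf_topology G D"
  have topC: "topspace ?C = C_inf G D"
    by (simp add: C_inf_topology_def C_inf_def topspace_inv_limit_topology)
  have into: "rho G D e \<in> C_inf G D" if "e \<in> topspace ?E" for e
    using that rho_end_of[OF exh] rho_path_eq(2)[OF exh] unfolding topspace_ends by auto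
  show "rho G D ` topspace ?E = topspace ?C"
  proof
    show "rho G D ` topspace ?E \<subseteq> topspace ?C" using into topC by blast
    show "topspace ?C \<subseteq> rho G D ` topspace ?E"
    proof
      fix x assume "x \<in> topspace ?C"
      then obtain p where "p \<in> Wan G" "rho_path G D p = x"
        using rho_surjective topC by blast
      then show "x \<in> rho G D ` topspace ?E"
        unfolding topspace_ends using rho_end_of[OF exh, of p] by (metis imageI)
    qed
  qed
  show "inj_on (rho G D) (topspace ?E)"
    unfolding topspace_ends inj_on_def
    using rho_end_of[OF exh] same_end_if_rho_eq end_of_eq by auto
  show "continuous_map ?E ?C (rho G D)"
    unfolding C_inf_topology_def
  proof (rule continuous_map_into_inv_limit)
    show "rho G D e \<in> inv_limit {1..} (\<lambda>m n. n = Suc m)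
        (\<lambda>n. components_of (remove_verts G (D n))) (C_bond G D)" if "e \<in> topspace ?E" for e
      using into[OF that] by (simp add: C_inf_def)
    fix n :: nat and c assume "n \<in> {1..}"
    then have n: "n \<ge> 1" by simp
    show "openin ?E {e \<in> topspace ?E. rho G D e n = c}"
    proof (subst openin_subopen, intro ballI)
      fix e assume "e \<in> {e \<in> topspace ?E. rho G D e n = c}"
      then obtain p where p: "p \<in> Wan G" "e = end_of G p" "rho_path G D p n = c"
        unfolding topspace_ends using rho_end_of[OF exh] by auto
      let ?T = "{end_of G q |q. q \<in> Wan G \<and> end_trace G (D (Suc n)) q = end_trace G (D (Suc n)) p}"
      have "openin ?E ?T"
        by (rule openin_basic) (auto simp: D_fin_parts end_trace_def)
      moreover have "e \<in> ?T" using p by blast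
      moreover have "?T \<subseteq> {e \<in> topspace ?E. rho G D e n = c}"
      proof
        fix e' assume "e' \<in> ?T"
        then obtain q where q: "q \<in> Wan G" "e' = end_of G q"
          "end_trace G (D (Suc n)) q = end_trace G (D (Suc n)) p" by blast
        have "rho_path G D q n = c" using rho_determined_by_end_trace[OF q(1) p(1) n q(3)] p(3) by simp
        then show "e' \<in> {e \<in> topspace ?E. rho G D e n = c}"
          unfolding topspace_ends using q rho_end_of[OF exh q(1)] by auto
      qed
      ultimately show "\<exists>T. openin ?E T \<and> e \<in> T \<and> T \<subseteq> {e \<in> topspace ?E. rho G D e n = c}" by blast
    qed
  qed
  show "open_map ?E ?C (rho G D)"
    unfolding open_map_def
  proof (intro allI impI)
    fix U assume U: "openin ?E U"
    show "openin ?C (rho G D ` U)"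
    proof (subst openin_subopen, intro ballI)
      fix y assume "y \<in> rho G D ` U"
      then obtain e where e: "e \<in> U" "y = rho G D e" by blast
      obtain B where B: "B \<in> end_base G" "e \<in> B" "B \<subseteq> U"
        using U e(1) unfolding openin_end_topology union_of_def arbitrary_def by blast
      obtain H p where H: "H \<in> fin_parts G" and p: "p \<in> Wan G" "e = end_of G p"
        and B_eq: "B = {end_of G q |q. q \<in> Wan G \<and> end_trace G H q = end_trace G H p}"
        using B(1,2) unfolding end_base_def by auto
      obtain n where n: "n \<ge> 1" and det: "\<And>p q. p \<in> Wan G \<Longrightarrow> q \<in> Wan G \<Longrightarrow>
          rho_path G D p n = rho_path G D q n \<Longrightarrow> end_trace G H p = end_trace G H q"
        using end_trace_determined_by_rho[OF H] by blast
      let ?T = "{z \<in> C_inf G D. z n = y n}"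
      have "openin ?C ?T"
        unfolding C_inf_topology_def C_inf_def by (rule openin_inv_limit_coordinate) (use n in simp)
      moreover have "y \<in> ?T"
        using e into openin_subset[OF U] by blast
      moreover have "?T \<subseteq> rho G D ` U"
      proof
        fix z assume z: "z \<in> ?T"
        then obtain q where q: "q \<in> Wan G" "rho_path G D q = z"
          using rho_surjective[of z] by blast
        have "rho_path G D q n = rho_path G D p n"
          using z q e(2) p rho_end_of[OF exh p(1)] by simp
        then have "end_of G q \<in> B" using det[OF q(1) p(1)] q(1) unfolding B_eq by blast
        then show "z \<in> rho G D ` U" using B(3) q rho_end_of[OF exh q(1)] by (metis image_eqI subsetD)
      qed
      ultimately show "\<exists>T. openin ?C T \<and> y \<in> T \<and> T \<subseteq> rho G D ` U" by blast
    qed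
  qed
qed

lemma compact_ends: "compact_space (end_topology G)"
proof -
  have "compact_space (C_inf_topology G D)"
    unfolding C_inf_topology_def by (rule compact_inv_limit) (simp add: finite_components)
  then show ?thesis
    using homeomorphic_compact_space[OF homeomorphic_map_imp_homeomorphic_space[OF homeomorphic_rho]]
    by simp
qed

lemma chi_in_inv_limit:
  assumes "e \<in> topspace (end_topology G)"
  shows "chi G e \<in> inv_limit (fin_parts G) (\<subseteq>) (X_part G) (X_bond G)"
proof -
  obtain p where p: "p \<in> Wan G" "e = end_of G p" using assms unfolding topspace_ends by blast
  then show ?thesis unfolding inv_limit_def using X_bond_eq[OF p(1)]
    by (auto simp: chi_end_of X_part_def)
qed

text \<open>
  For a thread \<open>x\<close>, the ends with trace \<open>x H\<close> on \<open>H\<close> form a closed set. Finitely many of these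
  sets have a common point, namely any end with the prescribed trace on the union of the sets \<open>H\<close>
  involved, so compactness provides an end that is mapped to \<open>x\<close>.
\<close>

lemma chi_surjective:
  assumes x: "x \<in> inv_limit (fin_parts G) (\<subseteq>) (X_part G) (X_bond G)"
  shows "x \<in> chi G ` topspace (end_topology G)"
proof -
  let ?E = "end_topology G"
  define F where "F H = {e \<in> topspace ?E. chi G e H = x H}" for H
  have closed: "closedin ?E (F H)" if H: "H \<in> fin_parts G" for H
  proof -
    have "topspace ?E - F H = (\<Union>I\<in>- {x H}. {e \<in> topspace ?E. chi G e H = I})"
      by (auto simp: F_def)
    also have "openin ?E \<dots>" using openin_chi[OF H] by blast
    finally show ?thesis by (auto simp: closedin_def F_def)
  qed
  have fip: "\<Inter> \<F> \<noteq> {}" if \<F>: "finite \<F>" "\<F> \<subseteq> F ` fin_parts G" for \<F>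
  proof -
    obtain \<H> where \<H>: "finite \<H>" "\<H> \<subseteq> fin_parts G" "\<F> = F ` \<H>"
      using finite_subset_image[OF \<F>] by blast
    \<comment> \<open>Inserting \<open>v0\<close> keeps \<open>K\<close> nonempty when the family is empty.\<close>
    define K where "K = insert v0 (\<Union> \<H>)"
    have K: "K \<in> fin_parts G" using \<H> v0_in by (auto simp: K_def fin_parts_def)
    then have "x K \<in> X_part G K" using x by (auto simp: inv_limit_def)
    then obtain p where p: "p \<in> Wan G" "x K = end_trace G K p" by (auto simp: X_part_def)
    have "end_of G p \<in> F H" if H: "H \<in> \<H>" for H
    proof -
      have HK: "H \<subseteq> K" "H \<in> fin_parts G" using H \<H> by (auto simp: K_def)
      then have "x H = X_bond G H K (x K)" using x K by (auto simp: inv_limit_def)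
      also have "\<dots> = end_trace G H p" using X_bond_eq[OF p(1) K HK(2,1)] p(2) by simp
      finally show ?thesis using p chi_at[OF p(1) HK(2)] by (simp add: F_def topspace_ends)
    qed
    then show ?thesis using \<H>(3) by blast
  qed
  have "\<Inter> (F ` fin_parts G) \<noteq> {}"
    using compact_ends[unfolded compact_space_fip, rule_format, of "F ` fin_parts G"] closed fip by blast
  then obtain e where e: "\<And>H. H \<in> fin_parts G \<Longrightarrow> e \<in> F H" by blast
  have "{v0} \<in> fin_parts G" using v0_in by (simp add: fin_parts_def)
  then have top: "e \<in> topspace ?E" using e by (auto simp: F_def)
  have "chi G e = x"
  proof (rule PiE_ext)
    show "chi G e \<in> Pi\<^sub>E (fin_parts G) (X_part G)" "x \<in> Pi\<^sub>E (fin_parts G) (X_part G)"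
      using chi_in_inv_limit[OF top] x by (auto simp: inv_limit_def)
    show "chi G e H = x H" if "H \<in> fin_parts G" for H using e[OF that] by (simp add: F_def)
  qed
  then show ?thesis using top by blast
qed

lemma homeomorphic_chi: "homeomorphic_map (end_topology G) (X_topology G) (chi G)"
proof (rule continuous_imp_homeomorphic_map)
  let ?E = "end_topology G"
  show "continuous_map ?E (X_topology G) (chi G)"
    unfolding X_topology_def
    by (rule continuous_map_into_inv_limit) (simp_all add: chi_in_inv_limit openin_chi)
  show "compact_space ?E" by (rule compact_ends)
  show "Hausdorff_space (X_topology G)"
    unfolding X_topology_def by (rule Hausdorff_inv_limit)
  show "chi G ` topspace ?E = topspace (X_topology G)"
    unfolding X_topology_def topspace_inv_limit_topology
    using chi_in_inv_limit chi_surjective by blast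
  show "inj_on (chi G) (topspace ?E)"
  proof (rule inj_onI)
    fix d e assume "d \<in> topspace ?E" "e \<in> topspace ?E" and eq: "chi G d = chi G e"
    then obtain p q where p: "p \<in> Wan G" "d = end_of G p" and q: "q \<in> Wan G" "e = end_of G q"
      unfolding topspace_ends by blast
    have tr: "end_trace G H p = end_trace G H q" if "H \<in> fin_parts G" for H
      using eq chi_at[OF p(1) that] chi_at[OF q(1) that] p q by simp
    have "rho_path G D p n = rho_path G D q n" if "n \<ge> 1" for n
      using rho_determined_by_end_trace[OF p(1) q(1) that] tr D_fin_parts by simp
    then have "rho_path G D p = rho_path G D q"
      using rho_path_eq(1)[OF exh p(1)] rho_path_eq(1)[OF exh q(1)]
      by (metis (no_types, lifting) atLeast_iff restrict_apply ext)
    then show "d = e" using same_end_if_rho_eq[OF p(1) q(1)] end_of_eq p q by simp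
  qed
qed

end


section \<open>The end space\<close>

theorem theorem6p12:
  fixes G :: "('v, 'e) pre_digraph" and v0 :: 'v and D :: "nat \<Rightarrow> 'v set"
  assumes "wf_digraph G"
    and "countable (verts G)" and "countable (arcs G)"
    and "infinite (verts G)"
    and "strongly_connected G"
    and "almost_undirected G"
    and "row_finite G"
    and "exhaustion G v0 D"
  shows "homeomorphic_map (end_topology G) (C_inf_topology G D) (rho G D)
    \<and> homeomorphic_map (end_topology G) (X_topology G) (chi G)
    \<and> compact_space (end_topology G)
    \<and> totally_disconnected_space (end_topology G)
    \<and> metrizable_space (end_topology G)"
proof -
  interpret wf_digraph G by fact
  interpret exhausted_digraph G v0 D by unfold_locales fact+
  have "totally_disconnected_space (end_topology G)"
    by (rule totally_disconnected_homeomorphic[OF homeomorphic_rho])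
      (simp add: C_inf_topology_def totally_disconnected_inv_limit)
  moreover have "metrizable_space (C_inf_topology G D)"
    unfolding C_inf_topology_def by (rule metrizable_inv_limit) simp
  then have "metrizable_space (end_topology G)"
    using homeomorphic_metrizable_space[OF homeomorphic_map_imp_homeomorphic_space[OF homeomorphic_rho]]
    by simp
  ultimately show ?thesis using homeomorphic_rho homeomorphic_chi compact_ends by blast
qed

end
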